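(* The critical connectivity $\mu_{\mathrm c}$ of networks of identical phase oscillators with unit-strength connections satisfies \[ \mu_{\mathrm c}\;\geq\;\frac{11}{19}-\frac{2}{19}\cdot\frac{\displaystyle\sum_{l=1}^{5}\left[-\cos\left(\frac{2\pi l}{19}\right)+\cos^{2}\left(\frac{2\pi l}{19}\right)\right]}{\displaystyle-\cos\left(\frac{12\pi}{19}\right)+\cos^{2}\left(\frac{12\pi}{19}\right)}=0.6838\cdots. \]
   Context: A network on $N$ nodes is given by a symmetric adjacency matrix $A=(a_{ij})_{1\le i,j\le N}$ with $a_{ij}=a_{ji}\in\{0,1\}$ and $a_{ii}=0$. The associated system of identical phase oscillators, with phases $\theta_i\in\mathbb{R}/2\pi\mathbb{Z}$, is \[ \frac{\mathrm{d}\theta_i}{\mathrm{d}t}=\sum_{j=1}^{N}a_{ij}\sin(\theta_j-\theta_i),\qquad i=1,\dots,N. \] The in-phase state is the state in which all $\theta_i$ are equal. States are considered up to the rotational symmetry $\theta_i\mapsto\theta_i+c$ for all $i$. An equilibrium is linearly stable if, apart from the one zero eigenvalue due to this rotational symmetry, all $N-1$ other eigenvalues of the Jacobian are negative. The network is globally synchronizing if the oscillators converge to the in-phase state for almost all initial conditions; in particular it is not globally synchronizing if there is a linearly stable equilibrium other than the in-phase state. The connectivity of the network is \[ \mu=\frac{\min_{1\le i\le N}\sum_{j=1}^{N}a_{ij}}{N-1}. \] The critical connectivity $\mu_{\mathrm c}$ is the smallest value of $\mu$ such that any network of $N$ identical phase oscillators with unit connections (any $N$) is globally synchronizing if its connectivity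 is at least $\mu_{\mathrm c}$; otherwise, for any $\mu<\mu_{\mathrm c}$, at least one network having some other attractor besides the in-phase state exists. *)

theory Defs
  imports "HOL-Analysis.Analysis"
begin

(* Nodes are 0, ..., N - 1; entries of A and of phase vectors outside this range are irrelevant. *)

definition network :: "nat \<Rightarrow> (nat \<Rightarrow> nat \<Rightarrow> real) \<Rightarrow> bool" where
  "network N A \<longleftrightarrow>
     (\<forall>i<N. \<forall>j<N. A i j \<in> {0, 1} \<and> A i j = A j i) \<and> (\<forall>i<N. A i i = 0)"

definition connectivity :: "nat \<Rightarrow> (nat \<Rightarrow> nat \<Rightarrow> real) \<Rightarrow> real" where
  "connectivity N A = (MIN i\<in>{..<N}. \<Sum>j<N. A i j) / (real N - 1)"

(* Phases in R/2piZ are represented by real lifts, since the vector field is 2pi-periodic. *)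
definition trajectory ::
    "nat \<Rightarrow> (nat \<Rightarrow> nat \<Rightarrow> real) \<Rightarrow> (real \<Rightarrow> nat \<Rightarrow> real) \<Rightarrow> bool" where
  "trajectory N A \<theta> \<longleftrightarrow>
     (\<forall>t\<ge>0. \<forall>i<N.
        ((\<lambda>s. \<theta> s i) has_real_derivative (\<Sum>j<N. A i j * sin (\<theta> t j - \<theta> t i)))
          (at t within {0..}))"

(* Convergence modulo 2pi and up to a common rotation: every phase difference tends to 0
   in R/2piZ. *)
definition converges_in_phase :: "nat \<Rightarrow> (real \<Rightarrow> nat \<Rightarrow> real) \<Rightarrow> bool" where
  "converges_in_phase N \<theta> \<longleftrightarrow>
     (\<forall>i<N. \<forall>j<N. ((\<lambda>t. cis (\<theta> t j - \<theta> t i)) \<longlongrightarrow> 1) at_top)"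

(* The vector field is globally Lipschitz, so each initial condition has exactly one trajectory
   on [0, \<infinity>) and the existential quantifier picks that one. By periodicity, a Lebesgue-null set
   of lifts in R^N is the same as a null set of the torus. *)
definition globally_synchronizing :: "nat \<Rightarrow> (nat \<Rightarrow> nat \<Rightarrow> real) \<Rightarrow> bool" where
  "globally_synchronizing N A \<longleftrightarrow>
     (AE \<theta>0 in Pi\<^sub>M {..<N} (\<lambda>_. lborel).
        \<exists>\<theta>. trajectory N A \<theta> \<and> (\<forall>i<N. \<theta> 0 i = \<theta>0 i) \<and> converges_in_phase N \<theta>)"

(* Inf is that of a set that is nonempty (no network has connectivity above 1) and bounded below
   (two uncoupled nodes have connectivity 0 and do not synchronize). N \<ge> 2 is needed for the
   denominator N - 1 of the connectivity. *)
definition critical_connectivity :: real where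
  "critical_connectivity =
     Inf {\<mu>. \<forall>N A. N \<ge> 2 \<longrightarrow> network N A \<longrightarrow> connectivity N A \<ge> \<mu> \<longrightarrow>
                globally_synchronizing N A}"

end

theory Submission
  imports Defs
begin

text \<open>
  Take 19 groups of \<open>m\<close> nodes arranged on a circle. Nodes whose groups have distance at most 5 are
  all adjacent; groups at distance 6 are joined by a \<open>d\<close>-regular bipartite graph. The connectivity
  tends to \<open>11/19 + (2/19) x\<close> as \<open>d/m\<close> tends to \<open>x\<close>. Giving group \<open>k\<close> the phase \<open>2 \<pi> k / 19\<close> yields an
  equilibrium. Its linearization splits into the deviations inside the groups, which are always
  strongly damped, and the group means, on which it is a circulant form diagonalized by the discrete
  Fourier transform. The modes 2 to 17 are stable even for \<open>d = m\<close>, and the modes 1 and 18 are stable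
  exactly when \<open>d/m\<close> is below the quotient in the theorem. Below this threshold a box around the
  equilibrium is trapped, so the network is not globally synchronizing.
\<close>

section \<open>Trapping near a stable equilibrium\<close>

text \<open>\<open>globally_synchronizing\<close> speaks of almost all initial conditions and not of
  eigenvalues, so linear stability has to yield a set of positive measure whose trajectories stay
  away from the in-phase state. Stability is therefore carried as coercivity: the form with weights
  \<open>A i j * cos (\<phi> j - \<phi> i)\<close> dominates a positive multiple of the sum of all
  squared differences. Both sides vanish along rotations, so the zero eigenvalue never has to be
  split off, and the multiple limits the size of the trap.

  The quotient in the theorem is, up to sign, the density x at which the mode 1 eigenvalue vanishes:
  that eigenvalue is a positive multiple of the sum of \<open>c19 l * (1 - c19 l)\<close> over l =
  1..5 plus x times \<open>c19 6 * (1 - c19 6)\<close>. The last term is negative, so edges at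
  distance 6 buy connectivity at the expense of stability, and the zero lies between 0.9965 and
  0.997: a full join at distance 6 is already unstable. Hence the partial join, whose density can
  approach the zero from below; its regularity is what decouples group means from
  deviations.\<close>

lemma abs_sin_add_linearization_le:
  fixes a x :: real
  shows "\<bar>sin (a + x) - sin a - x * cos a\<bar> \<le> x\<^sup>2"
proof -
  obtain t where "sin x = (\<Sum>m<2. sin_coeff m * x ^ m) + (sin (t + 1/2 * real 2 * pi) / fact 2) * x ^ 2"
    using Maclaurin_sin_expansion[of x 2] by blast
  then have "sin x - x = - (sin t / 2) * x\<^sup>2"
    by (simp add: numeral_2_eq_2 sin_coeff_def)
  then have "\<bar>sin x - x\<bar> = \<bar>sin t\<bar> / 2 * x\<^sup>2"
    by (simp add: abs_mult)
  also have "\<dots> \<le> 1 / 2 * x\<^sup>2"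
    by (intro mult_right_mono) auto
  finally have s: "\<bar>sin x - x\<bar> \<le> x\<^sup>2 / 2" by simp
  have "cos x = 1 - 2 * (sin (x / 2))\<^sup>2"
    using cos_double_sin[of "x / 2"] by simp
  moreover have "(sin (x / 2))\<^sup>2 \<le> (x / 2)\<^sup>2"
    using abs_sin_x_le_abs_x[of "x / 2"] by (simp only: abs_le_square_iff)
  ultimately have c: "\<bar>cos x - 1\<bar> \<le> x\<^sup>2 / 2"
    by (simp add: power_divide)
  have "\<bar>sin a * (cos x - 1)\<bar> \<le> 1 * (x\<^sup>2 / 2)" "\<bar>cos a * (sin x - x)\<bar> \<le> 1 * (x\<^sup>2 / 2)"
    unfolding abs_mult using s c by (intro mult_mono; simp)+
  moreover have "sin (a + x) - sin a - x * cos a = sin a * (cos x - 1) + cos a * (sin x - x)"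
    by (simp add: sin_add algebra_simps)
  ultimately show ?thesis by linarith
qed

lemma emeasure_box_pos:
  fixes p :: "nat \<Rightarrow> real"
  assumes "e > 0"
  shows "emeasure (Pi\<^sub>M {..<N} (\<lambda>_. lborel)) (\<Pi>\<^sub>E i\<in>{..<N}. {p i - e<..<p i + e}) > 0"
proof -
  interpret product_sigma_finite "\<lambda>_::nat. lborel :: real measure"
    by unfold_locales
  have "emeasure (Pi\<^sub>M {..<N} (\<lambda>_. lborel)) (\<Pi>\<^sub>E i\<in>{..<N}. {p i - e<..<p i + e})
      = (\<Prod>i<N. ennreal (2 * e))"
    using assms by (subst emeasure_PiM) auto
  also have "\<dots> = ennreal ((2 * e) ^ N)"
    using assms by (subst prod_ennreal) auto
  finally show ?thesis using assms by simp
qed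

text \<open>A null set cannot contain a box of positive volume. This turns the almost-everywhere
  statement in \<open>globally_synchronizing\<close> into one synchronizing trajectory that starts
  as close to the equilibrium as desired.\<close>

lemma AE_PiM_lborel_box_witness:
  fixes p :: "nat \<Rightarrow> real"
  assumes "AE x in Pi\<^sub>M {..<N} (\<lambda>_. lborel). P x" "e > 0"
  obtains x where "P x" "\<And>i. i < N \<Longrightarrow> \<bar>x i - p i\<bar> < e"
proof -
  let ?M = "Pi\<^sub>M {..<N} (\<lambda>_. lborel :: real measure)"
  let ?B = "\<Pi>\<^sub>E i\<in>{..<N}. {p i - e<..<p i + e}"
  have "\<exists>x\<in>?B. P x"
  proof (rule ccontr)
    assume no: "\<not> ?thesis"
    obtain Z where Z: "{x \<in> space ?M. \<not> P x} \<subseteq> Z" "emeasure ?M Z = 0" "Z \<in> sets ?M"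
      using AE_E[OF assms(1)] by blast
    have "?B \<subseteq> Z"
      using no Z(1) by (force simp: space_PiM PiE_iff)
    then have "emeasure ?M ?B \<le> emeasure ?M Z"
      using Z(3) by (rule emeasure_mono)
    then show False
      using emeasure_box_pos[OF assms(2), of N p] Z(2) by simp
  qed
  then obtain x where x: "x \<in> ?B" "P x" by blast
  have "\<bar>x i - p i\<bar> < e" if "i < N" for i
    using PiE_mem[OF x(1), of i] that by (auto simp: abs_less_iff)
  then show thesis using that x(2) by blast
qed

text \<open>At the first time \<open>T\<close> with \<open>V T \<ge> r\<close>, the derivative has
  been nonpositive on all of the interval before \<open>T\<close>, so
  \<open>V T \<le> V 0 < r\<close>. The sign of \<open>V'\<close> is thus only required below the
  barrier, which is all that a local Lyapunov function offers.\<close>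

lemma barrier_nonincreasing:
  fixes V V' :: "real \<Rightarrow> real"
  assumes deriv: "\<And>t. t \<ge> 0 \<Longrightarrow> (V has_real_derivative V' t) (at t within {0..})"
    and dec: "\<And>t. t \<ge> 0 \<Longrightarrow> V t < r \<Longrightarrow> V' t \<le> 0"
    and init: "V 0 < r" and "t \<ge> 0"
  shows "V t < r"
proof (rule ccontr)
  assume nt: "\<not> V t < r"
  have cont: "continuous_on {0..} V"
    using deriv by (auto intro!: DERIV_continuous_on)
  let ?S = "{0..t} \<inter> V -` {r..}"
  have "continuous_on {0..t} V"
    by (rule continuous_on_subset[OF cont]) auto
  then have "closed ?S"
    by (intro continuous_closed_preimage) auto
  then have "compact ?S"
    using bounded_subset[OF bounded_closed_interval[of 0 t]] by (auto simp: compact_eq_bounded_closed)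
  then obtain T where T: "T \<in> ?S" and Tmin: "\<And>s. s \<in> ?S \<Longrightarrow> T \<le> s"
    using compact_attains_inf[of ?S] nt \<open>t \<ge> 0\<close>
    by (metis IntI atLeastAtMost_iff atLeast_iff empty_iff not_less order_refl vimageI)
  have "V 0 \<ge> V T"
  proof (rule DERIV_nonpos_imp_decreasing_open[where f = V])
    show "0 \<le> T" using T by auto
    show "continuous_on {0..T} V"
      by (rule continuous_on_subset[OF cont]) auto
    fix s assume s: "0 < s" "s < T"
    then have "V s < r" using Tmin[of s] T by force
    moreover have "(V has_real_derivative V' s) (at s)"
      using deriv[of s] s at_within_interior[of s "{0..}"] by (simp add: interior_Ici)
    ultimately show "\<exists>y. DERIV V s :> y \<and> y \<le> 0"
      using dec[of s] s by auto
  qed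
  then show False using T init by auto
qed

text \<open>
  The sum of squared phase differences from the equilibrium is a Lyapunov function on the region
  where it is below \<open>r\<^sup>2\<close>: there the cubic error of linearizing the sine is absorbed by the
  coercive quadratic form.
\<close>

lemma trajectory_stays_near_equilibrium:
  fixes \<phi> :: "nat \<Rightarrow> real" and \<theta> :: "real \<Rightarrow> nat \<Rightarrow> real"
  assumes net: "network N A"
    and eq: "\<And>i. i < N \<Longrightarrow> (\<Sum>j<N. A i j * sin (\<phi> j - \<phi> i)) = 0"
    and coercive: "\<And>\<delta>. r * (\<Sum>i<N. \<Sum>j<N. (\<delta> j - \<delta> i)\<^sup>2)
        \<le> (\<Sum>i<N. \<Sum>j<N. A i j * cos (\<phi> j - \<phi> i) * (\<delta> j - \<delta> i)\<^sup>2)"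
    and "r > 0" and traj: "trajectory N A \<theta>"
    and init: "(\<Sum>i<N. \<Sum>j<N. ((\<theta> 0 j - \<phi> j) - (\<theta> 0 i - \<phi> i))\<^sup>2) < r\<^sup>2"
    and "t \<ge> 0"
  shows "(\<Sum>i<N. \<Sum>j<N. ((\<theta> t j - \<phi> j) - (\<theta> t i - \<phi> i))\<^sup>2) < r\<^sup>2"
proof -
  define d where "d t i j = (\<theta> t j - \<phi> j) - (\<theta> t i - \<phi> i)" for t i j
  define F where "F t i = (\<Sum>j<N. A i j * sin (\<theta> t j - \<theta> t i))" for t i
  define V where "V t = (\<Sum>i<N. \<Sum>j<N. (d t i j)\<^sup>2)" for t
  define V' where "V' t = (\<Sum>i<N. \<Sum>j<N. 2 * d t i j * (F t j - F t i))" for t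
  have sym: "A i j = A j i" if "i < N" "j < N" for i j
    using net that unfolding network_def by blast
  have "A i j \<in> {0, 1}" if "i < N" "j < N" for i j
    using net that unfolding network_def by blast
  then have A01: "0 \<le> A i j" "A i j \<le> 1" if "i < N" "j < N" for i j
    using that by fastforce+
  \<comment> \<open>Averaging a double sum with its transpose turns \<open>g i\<close> into the
    difference \<open>g j - g i\<close>. It is used with \<open>g\<close> constant (the velocities
    sum to zero) and with \<open>g\<close> the deviation, once for the actual phases and once for
    the equilibrium.\<close>
  have skew: "(\<Sum>i<N. \<Sum>j<N. A i j * g i * s i j) = - (1/2) * (\<Sum>i<N. \<Sum>j<N. A i j * (g j - g i) * s i j)"
    if "\<And>i j. s j i = - s i j" for g :: "nat \<Rightarrow> real" and s
  proof -
    have "(\<Sum>i<N. \<Sum>j<N. A i j * g i * s i j) = (\<Sum>i<N. \<Sum>j<N. A j i * g j * s j i)"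
      by (rule sum.swap)
    also have "\<dots> = - (\<Sum>i<N. \<Sum>j<N. A i j * g j * s i j)"
      unfolding sum_negf[symmetric]
    proof (intro sum.cong refl)
      fix i j assume "i \<in> {..<N}" "j \<in> {..<N}"
      then show "A j i * g j * s j i = - (A i j * g j * s i j)"
        using sym[of i j] that[of j i] by simp
    qed
    finally show ?thesis
      by (simp add: right_diff_distrib left_diff_distrib sum_subtractf)
  qed
  have "V t < r\<^sup>2"
  proof (rule barrier_nonincreasing[where V = V and V' = V'])
    fix t :: real assume t: "t \<ge> 0"
    have "((\<lambda>s. \<theta> s i) has_real_derivative F t i) (at t within {0..})" if "i < N" for i
      using traj t that unfolding trajectory_def F_def by blast
    then show "(V has_real_derivative V' t) (at t within {0..})"
      unfolding V_def V'_def d_def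
      by (auto intro!: DERIV_sum derivative_eq_intros)
    assume small: "V t < r\<^sup>2"
    have dr: "\<bar>d t i j\<bar> < r" if "i < N" "j < N" for i j
    proof -
      have "(d t i j)\<^sup>2 \<le> (\<Sum>j<N. (d t i j)\<^sup>2)"
        by (rule member_le_sum) (use that in auto)
      also have "\<dots> \<le> V t"
        unfolding V_def by (rule member_le_sum[where i = i]) (use that in \<open>auto intro: sum_nonneg\<close>)
      finally show ?thesis
        using small \<open>r > 0\<close> by (metis abs_le_square_iff abs_of_pos leD le_less_trans not_le)
    qed
    have F0: "(\<Sum>i<N. F t i) = 0"
      using skew[of "\<lambda>i j. sin (\<theta> t j - \<theta> t i)" "\<lambda>_. 1"]
      unfolding F_def by (simp add: sin_diff)
    let ?\<delta> = "\<lambda>i. \<theta> t i - \<phi> i"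
    \<comment> \<open>The two mixed terms factor into the sum of the deviations times the sum of the
      velocities, which is 0 by \<open>F0\<close>. The two diagonal terms are equal, whence the
      factor \<open>4 * real N\<close>.\<close>
    have "V' t = 2 * (\<Sum>i<N. \<Sum>j<N. ?\<delta> j * F t j - ?\<delta> j * F t i - ?\<delta> i * F t j + ?\<delta> i * F t i)"
      unfolding V'_def d_def sum_distrib_left by (intro sum.cong refl) (simp add: algebra_simps)
    also have "\<dots> = 4 * real N * (\<Sum>i<N. ?\<delta> i * F t i)"
      by (simp add: sum.distrib sum_subtractf flip: sum_distrib_left sum_distrib_right)
        (simp add: F0 flip: sum_distrib_left sum_distrib_right)
    also have "(\<Sum>i<N. ?\<delta> i * F t i) = (\<Sum>i<N. \<Sum>j<N. A i j * ?\<delta> i * sin (\<theta> t j - \<theta> t i))"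
      unfolding F_def sum_distrib_left by (simp add: mult_ac)
    also have "\<dots> = - (1/2) * (\<Sum>i<N. \<Sum>j<N. A i j * d t i j * sin (\<theta> t j - \<theta> t i))"
      unfolding d_def by (rule skew) (simp add: sin_diff)
    finally have V'eq: "V' t = - 2 * real N * (\<Sum>i<N. \<Sum>j<N. A i j * d t i j * sin (\<theta> t j - \<theta> t i))"
      by simp
    have 0: "(\<Sum>i<N. \<Sum>j<N. A i j * d t i j * sin (\<phi> j - \<phi> i)) = 0"
    proof -
      have "(\<Sum>i<N. \<Sum>j<N. A i j * ?\<delta> i * sin (\<phi> j - \<phi> i)) = (\<Sum>i<N. ?\<delta> i * (\<Sum>j<N. A i j * sin (\<phi> j - \<phi> i)))"
        by (simp add: sum_distrib_left mult_ac)
      also have "\<dots> = 0" using eq by simp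
      finally show ?thesis
        using skew[of "\<lambda>i j. sin (\<phi> j - \<phi> i)" ?\<delta>] unfolding d_def by (simp add: sin_diff)
    qed
    \<comment> \<open>The same \<open>r\<close> bounds the differences in the trap and is the
      coercivity constant, so the summed errors are at most what \<open>coercive\<close>
      provides.\<close>
    have "A i j * d t i j * sin (\<theta> t j - \<theta> t i) \<ge> A i j * d t i j * sin (\<phi> j - \<phi> i)
        + A i j * cos (\<phi> j - \<phi> i) * (d t i j)\<^sup>2 - r * (d t i j)\<^sup>2" if "i < N" "j < N" for i j
    proof -
      let ?a = "\<phi> j - \<phi> i" and ?x = "d t i j"
      let ?e = "sin (?a + ?x) - sin ?a - ?x * cos ?a"
      have "\<bar>A i j * ?x * ?e\<bar> \<le> 1 * r * ?x\<^sup>2"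
        unfolding abs_mult using A01[OF that] dr[OF that] abs_sin_add_linearization_le[of ?a ?x] \<open>r > 0\<close>
        by (intro mult_mono) auto
      moreover have "sin (\<theta> t j - \<theta> t i) = sin (?a + ?x)" by (simp add: d_def)
      ultimately show ?thesis
        by (simp only:) (simp add: abs_le_iff algebra_simps power2_eq_square)
    qed
    then have "(\<Sum>i<N. \<Sum>j<N. A i j * d t i j * sin (\<phi> j - \<phi> i)
          + A i j * cos (\<phi> j - \<phi> i) * (d t i j)\<^sup>2 - r * (d t i j)\<^sup>2)
        \<le> (\<Sum>i<N. \<Sum>j<N. A i j * d t i j * sin (\<theta> t j - \<theta> t i))" (is "?lo \<le> _")
      by (intro sum_mono) auto
    moreover have "?lo \<ge> 0"
      using 0 coercive[of ?\<delta>] by (simp add: sum.distrib sum_subtractf sum_distrib_left d_def)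
    ultimately show "V' t \<le> 0"
      unfolding V'eq by (simp add: mult_nonneg_nonneg)
  qed (use init \<open>t \<ge> 0\<close> in \<open>auto simp: V_def d_def\<close>)
  then show ?thesis by (simp add: V_def d_def)
qed

text \<open>A synchronizing trajectory that starts near \<open>\<phi>\<close> is trapped there, so
  \<open>cis (\<theta> t b - \<theta> t a)\<close> stays within \<open>r\<close> of a point of the
  unit circle other than 1 and cannot tend to 1.\<close>

lemma stable_equilibrium_not_globally_synchronizing:
  fixes \<phi> :: "nat \<Rightarrow> real"
  assumes net: "network N A"
    and eq: "\<And>i. i < N \<Longrightarrow> (\<Sum>j<N. A i j * sin (\<phi> j - \<phi> i)) = 0"
    and coercive: "\<And>\<delta>. c * (\<Sum>i<N. \<Sum>j<N. (\<delta> j - \<delta> i)\<^sup>2)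
        \<le> (\<Sum>i<N. \<Sum>j<N. A i j * cos (\<phi> j - \<phi> i) * (\<delta> j - \<delta> i)\<^sup>2)"
    and "c > 0" and ab: "a < N" "b < N" "cis (\<phi> b - \<phi> a) \<noteq> 1"
  shows "\<not> globally_synchronizing N A"
proof
  assume gs: "globally_synchronizing N A"
  define \<eta> where "\<eta> = dist (cis (\<phi> b - \<phi> a)) 1"
  \<comment> \<open>\<open>r \<le> c\<close> keeps the form coercive with constant \<open>r\<close>;
    \<open>r < \<eta>\<close> leaves the limit 1 outside the closed ball of radius \<open>r\<close>
    about \<open>cis (\<phi> b - \<phi> a)\<close>.\<close>
  define r where "r = min c (\<eta> / 2)"
  have "\<eta> > 0" using ab by (simp add: \<eta>_def)
  then have r: "r > 0" "r \<le> c" "r < \<eta>" using \<open>c > 0\<close> by (auto simp: r_def)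
  have "N > 0" using ab by simp
  \<comment> \<open>In the box every difference of deviations is below \<open>2 * e\<close>, and
    there are \<open>N * N\<close> pairs, so the squares sum to less than
    \<open>(2 * e * N)\<^sup>2 = r\<^sup>2\<close>.\<close>
  define e where "e = r / (2 * real N)"
  have "e > 0" using r \<open>N > 0\<close> by (simp add: e_def)
  obtain \<theta>0 where "\<exists>\<theta>. trajectory N A \<theta> \<and> (\<forall>i<N. \<theta> 0 i = \<theta>0 i) \<and> converges_in_phase N \<theta>"
    and box: "\<And>i. i < N \<Longrightarrow> \<bar>\<theta>0 i - \<phi> i\<bar> < e"
    using AE_PiM_lborel_box_witness[OF gs[unfolded globally_synchronizing_def] \<open>e > 0\<close>, of \<phi>] by blast
  then obtain \<theta> where tr: "trajectory N A \<theta>" and start: "\<And>i. i < N \<Longrightarrow> \<theta> 0 i = \<theta>0 i"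
    and conv: "converges_in_phase N \<theta>" by blast
  have "(\<Sum>i<N. \<Sum>j<N. ((\<theta> 0 j - \<phi> j) - (\<theta> 0 i - \<phi> i))\<^sup>2) < (\<Sum>i<N. \<Sum>j<N. (2 * e)\<^sup>2)"
  proof (intro sum_strict_mono)
    fix i j assume "i \<in> {..<N}" "j \<in> {..<N}"
    then have "\<bar>(\<theta> 0 j - \<phi> j) - (\<theta> 0 i - \<phi> i)\<bar> < \<bar>2 * e\<bar>"
      using box[of i] box[of j] start[of i] start[of j] by simp
    then show "((\<theta> 0 j - \<phi> j) - (\<theta> 0 i - \<phi> i))\<^sup>2 < (2 * e)\<^sup>2"
      by (metis abs_le_square_iff not_le)
  qed (use \<open>N > 0\<close> in auto)
  also have "\<dots> = r\<^sup>2"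
    using \<open>N > 0\<close> by (simp add: e_def power2_eq_square field_simps)
  finally have init: "(\<Sum>i<N. \<Sum>j<N. ((\<theta> 0 j - \<phi> j) - (\<theta> 0 i - \<phi> i))\<^sup>2) < r\<^sup>2" .
  have coercive': "r * (\<Sum>i<N. \<Sum>j<N. (\<delta> j - \<delta> i)\<^sup>2)
        \<le> (\<Sum>i<N. \<Sum>j<N. A i j * cos (\<phi> j - \<phi> i) * (\<delta> j - \<delta> i)\<^sup>2)" for \<delta>
    using r(2) by (intro order_trans[OF _ coercive] mult_right_mono sum_nonneg) auto
  have near: "dist (cis (\<theta> t b - \<theta> t a)) (cis (\<phi> b - \<phi> a)) \<le> r" if "t \<ge> 0" for t
  proof -
    let ?x = "(\<theta> t b - \<phi> b) - (\<theta> t a - \<phi> a)"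
    have "?x\<^sup>2 \<le> (\<Sum>j<N. ((\<theta> t j - \<phi> j) - (\<theta> t a - \<phi> a))\<^sup>2)"
      by (rule member_le_sum[where i = b]) (use ab in auto)
    also have "\<dots> \<le> (\<Sum>i<N. \<Sum>j<N. ((\<theta> t j - \<phi> j) - (\<theta> t i - \<phi> i))\<^sup>2)"
      by (rule member_le_sum[where i = a]) (use ab in \<open>auto intro: sum_nonneg\<close>)
    also have "\<dots> < r\<^sup>2"
      by (rule trajectory_stays_near_equilibrium[OF net eq coercive' r(1) tr init that])
    finally have "\<bar>?x\<bar> \<le> r"
      using r(1) abs_le_square_iff[of ?x r] by simp
    have "\<theta> t b - \<theta> t a = (\<phi> b - \<phi> a) + ?x" by simp
    then have "cis (\<theta> t b - \<theta> t a) - cis (\<phi> b - \<phi> a) = cis (\<phi> b - \<phi> a) * (cis ?x - 1)"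
      by (simp only: cis_mult[symmetric] right_diff_distrib mult_1_right)
    then have "dist (cis (\<theta> t b - \<theta> t a)) (cis (\<phi> b - \<phi> a)) = norm (cis ?x - 1)"
      by (simp only: dist_norm norm_mult norm_cis mult_1_left)
    also have "\<dots> \<le> \<bar>?x\<bar>"
      using dist_exp_i_1[of ?x] abs_sin_x_le_abs_x[of "?x / 2"] by (simp add: cis_conv_exp dist_norm)
    finally show ?thesis using \<open>\<bar>?x\<bar> \<le> r\<close> by simp
  qed
  have "((\<lambda>t. cis (\<theta> t b - \<theta> t a)) \<longlongrightarrow> 1) at_top"
    using conv ab by (simp add: converges_in_phase_def)
  then have "((\<lambda>t. dist (cis (\<theta> t b - \<theta> t a)) (cis (\<phi> b - \<phi> a))) \<longlongrightarrow> dist 1 (cis (\<phi> b - \<phi> a))) at_top"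
    by (intro tendsto_intros)
  then have "dist 1 (cis (\<phi> b - \<phi> a)) \<le> r"
    by (rule tendsto_upperbound) (use near in \<open>auto intro: eventually_mono[OF eventually_ge_at_top[of 0]]\<close>)
  then show False using r by (simp add: \<eta>_def dist_commute)
qed

section \<open>The cosines of the multiples of $2\pi/19$\<close>

definition c19 :: "nat \<Rightarrow> real" where
  "c19 j = cos (2 * pi * real j / 19)"

lemma c19_mult: "j \<le> i \<Longrightarrow> c19 i * c19 j = (c19 (i + j) + c19 (i - j)) / 2"
  unfolding c19_def cos_times_cos by (simp add: of_nat_diff algebra_simps diff_divide_distrib add_divide_distrib)

lemma c19_reflect:
  assumes "j \<le> 19"
  shows "c19 (19 - j) = c19 j"
proof -
  have "2 * pi * real (19 - j) / 19 = 2 * pi - 2 * pi * real j / 19"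
    using assms by (simp add: of_nat_diff field_simps)
  then show ?thesis unfolding c19_def by (simp only: cos_2pi_minus)
qed

lemma c19_mod: "c19 (n mod 19) = c19 n"
proof -
  have "real n = real (n mod 19) + 19 * real (n div 19)"
    by (metis mod_mult_div_eq of_nat_add of_nat_mult of_nat_numeral)
  then have "2 * pi * real n / 19 = 2 * pi * real (n mod 19) / 19 + 2 * pi * real (n div 19)"
    by (simp add: field_simps)
  moreover have "cos (2 * pi * real m) = 1" "sin (2 * pi * real m) = 0" for m
    using cos_2npi[of m] sin_2npi[of m] by (simp_all add: mult_ac)
  ultimately show ?thesis
    unfolding c19_def by (simp only: cos_add mult_zero_right mult_1_right mult_1_left mult_zero_left diff_0_right)
qed

section \<open>Decimal enclosures of the cosines\<close>

lemma c19_0 [simp]: "c19 0 = 1"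
  by (simp add: c19_def)

text \<open>The only transcendental estimate; the other cosines follow by the addition formula.
  Three errors add up: the Taylor remainder, the rounding of the polynomial's value, and the
  replacement of 2 pi/19 by a decimal.\<close>

lemma c19_1_approx: "\<bar>c19 1 - 0.9458172417\<bar> \<le> 1 / 10 ^ 8"
proof -
  \<comment> \<open>2 pi/19 cut off after eight decimals.\<close>
  define x :: real where "x = 0.33069396"
  have x_square: "x^2 = 0.1093584951804816"
    by (simp add: x_def power_divide)
  \<comment> \<open>The Taylor polynomial of degree 8 in Horner form, so that inserting
    \<open>x_square\<close> leaves plain rational arithmetic.\<close>
  define P where "P = 1 - x^2 * (1/2 - x^2 * (1/24 - x^2 * (1/720 - x^2 / 40320)))"
  obtain t where t: "cos x = (\<Sum>m<10. cos_coeff m * x ^ m) + (cos (t + 1/2 * real 10 * pi) / fact 10) * x ^ 10"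
    using Maclaurin_cos_expansion[of x 10] by blast
  have "(\<Sum>m<10. cos_coeff m * x ^ m) = P"
    by (simp add: P_def lessThan_nat_numeral lessThan_Suc cos_coeff_def fact_numeral algebra_simps
        flip: power_add)
  then have "cos x - P = cos (t + 1/2 * real 10 * pi) * (x ^ 10 / fact 10)"
    unfolding t by simp
  also have "\<bar>\<dots>\<bar> \<le> 1 * (x ^ 10 / fact 10)"
    unfolding abs_mult by (intro mult_mono) (auto simp: x_def)
  also have "\<dots> \<le> 1 * ((1/3) ^ 10 / fact 10)"
    by (intro mult_left_mono divide_right_mono power_mono) (simp_all add: x_def)
  also have "\<dots> \<le> 1 / 10 ^ 11"
    by (simp add: fact_numeral power_divide)
  finally have "\<bar>cos x - P\<bar> \<le> 1 / 10 ^ 11" .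
  moreover have "\<bar>P - 0.9458172417\<bar> \<le> 2 / 10 ^ 9"
    unfolding P_def x_square by simp
  moreover have "\<bar>cos (2 * pi / 19) - cos x\<bar> \<le> 5 / 10 ^ 9"
  proof -
    have "\<bar>x - 2 * pi / 19\<bar> \<le> 5 / 10 ^ 9"
      using pi_approx by (simp add: abs_le_iff x_def)
    moreover have "cos (2 * pi / 19) - cos x = 2 * sin ((2 * pi / 19 + x) / 2) * sin ((x - 2 * pi / 19) / 2)"
      by (rule cos_diff_cos)
    moreover have "\<bar>2 * sin ((2 * pi / 19 + x) / 2) * sin ((x - 2 * pi / 19) / 2)\<bar>
        \<le> 2 * 1 * \<bar>(x - 2 * pi / 19) / 2\<bar>"
      unfolding abs_mult by (intro mult_mono abs_sin_x_le_abs_x) auto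
    ultimately show ?thesis by simp
  qed
  moreover have "\<bar>a - d\<bar> \<le> u + v + w"
    if "\<bar>b - c\<bar> \<le> u" "\<bar>c - d\<bar> \<le> v" "\<bar>a - b\<bar> \<le> w" for a b c d u v w :: real
    using that by linarith
  ultimately have "\<bar>cos (2 * pi / 19) - 0.9458172417\<bar> \<le> 1 / 10 ^ 11 + 2 / 10 ^ 9 + 5 / 10 ^ 9"
    by blast
  then show ?thesis by (simp add: c19_def)
qed

text \<open>Error propagation through the recurrence cos(p + q) = 2 cos p cos q - cos(p - q):
  \<open>u\<close> and \<open>v\<close> are doubled since the other factor is at most 1 in modulus,
  and \<open>e\<close> is the rounding of the new decimal.\<close>

lemma c19_add_approx:
  assumes "\<bar>c19 i - a\<bar> \<le> u" "\<bar>c19 j - b\<bar> \<le> v" "\<bar>c19 l - c\<bar> \<le> w"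
    and "j \<le> i" "l = i - j" "k = i + j"
    and "\<bar>b\<bar> \<le> 1" "\<bar>2 * (a * b) - c - d\<bar> \<le> e" "e + 2 * u + 2 * v + w \<le> z"
  shows "\<bar>c19 k - d\<bar> \<le> z"
proof -
  have "\<bar>c19 i * (c19 j - b)\<bar> \<le> 1 * v" "\<bar>(c19 i - a) * b\<bar> \<le> u * 1"
    unfolding abs_mult
    by (intro mult_mono assms(1,2,7) order_trans[OF abs_ge_zero assms(1)]; simp add: c19_def)+
  then have "\<bar>c19 i * c19 j - a * b\<bar> \<le> u + v"
    by (simp add: algebra_simps)
  moreover have "c19 k = 2 * (c19 i * c19 j) - c19 l"
    using assms(4-6) c19_mult[OF \<open>j \<le> i\<close>] by simp
  ultimately show ?thesis
    using assms(3,8,9) by linarith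
qed

text \<open>Each index is split into halves that differ by 0 or 1, so the subtracted cosine is 1 or
  \<open>c19 1\<close>. This short addition chain keeps the error at 125 / 10^8; the bounds are the
  values of \<open>e + 2 * u + 2 * v + w\<close>, the last one rounded up.\<close>

lemma c19_approx:
  "\<bar>c19 1 - 0.9458172417\<bar> \<le> 1 / 10^8"
  "\<bar>c19 2 - 0.7891405094\<bar> \<le> 5 / 10^8"
  "\<bar>c19 3 - 0.5469481581\<bar> \<le> 14 / 10^8"
  "\<bar>c19 4 - 0.2454854871\<bar> \<le> 21 / 10^8"
  "\<bar>c19 5 + 0.0825793455\<bar> \<le> 40 / 10^8"
  "\<bar>c19 6 + 0.4016954247\<bar> \<le> 57 / 10^8"
  "\<bar>c19 7 + 0.6772815716\<bar> \<le> 72 / 10^8"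
  "\<bar>c19 8 + 0.8794737512\<bar> \<le> 85 / 10^8"
  "\<bar>c19 9 + 0.9863613034\<bar> \<le> 125 / 10^8"
proof -
  show c1: "\<bar>c19 1 - 0.9458172417\<bar> \<le> 1 / 10^8"
    using c19_1_approx by simp
  have c0: "\<bar>c19 0 - 1\<bar> \<le> 0"
    by simp
  have d2: "\<bar>c19 2 - (0.7891405094)\<bar> \<le> 5 / 10^8"
    by (rule c19_add_approx[where e = "1 / 10^8", OF c1 c1 c0]) simp_all
  then show "\<bar>c19 2 - 0.7891405094\<bar> \<le> 5 / 10^8" by simp
  have d3: "\<bar>c19 3 - (0.5469481581)\<bar> \<le> 14 / 10^8"
    by (rule c19_add_approx[where e = "1 / 10^8", OF d2 c1 c1]) simp_all
  then show "\<bar>c19 3 - 0.5469481581\<bar> \<le> 14 / 10^8" by simp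
  have d4: "\<bar>c19 4 - (0.2454854871)\<bar> \<le> 21 / 10^8"
    by (rule c19_add_approx[where e = "1 / 10^8", OF d2 d2 c0]) simp_all
  then show "\<bar>c19 4 - 0.2454854871\<bar> \<le> 21 / 10^8" by simp
  have d5: "\<bar>c19 5 - (- 0.0825793455)\<bar> \<le> 40 / 10^8"
    by (rule c19_add_approx[where e = "1 / 10^8", OF d3 d2 c1]) simp_all
  then show "\<bar>c19 5 + 0.0825793455\<bar> \<le> 40 / 10^8" by simp
  have d6: "\<bar>c19 6 - (- 0.4016954247)\<bar> \<le> 57 / 10^8"
    by (rule c19_add_approx[where e = "1 / 10^8", OF d3 d3 c0]) simp_all
  then show "\<bar>c19 6 + 0.4016954247\<bar> \<le> 57 / 10^8" by simp
  have d7: "\<bar>c19 7 - (- 0.6772815716)\<bar> \<le> 72 / 10^8"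
    by (rule c19_add_approx[where e = "1 / 10^8", OF d4 d3 c1]) simp_all
  then show "\<bar>c19 7 + 0.6772815716\<bar> \<le> 72 / 10^8" by simp
  have d8: "\<bar>c19 8 - (- 0.8794737512)\<bar> \<le> 85 / 10^8"
    by (rule c19_add_approx[where e = "1 / 10^8", OF d4 d4 c0]) simp_all
  then show "\<bar>c19 8 + 0.8794737512\<bar> \<le> 85 / 10^8" by simp
  have d9: "\<bar>c19 9 - (- 0.9863613034)\<bar> \<le> 125 / 10^8"
    by (rule c19_add_approx[where e = "1 / 10^8", OF d5 d4 c1]) simp_all
  then show "\<bar>c19 9 + 0.9863613034\<bar> \<le> 125 / 10^8" by simp
qed

lemma c19_min_mod: "c19 n = c19 (min (n mod 19) (19 - n mod 19))"
  using c19_mod[of n] c19_reflect[of "n mod 19"] by (auto simp: min_def)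

text \<open>
  The side condition keeps this from looping as a rewrite rule: it reduces every index to one
  between 0 and 9. Together with the product-to-sum formula it makes all inequalities below linear in
  these ten cosines.
\<close>

lemma c19_fold:
  assumes "10 \<le> (numeral n :: nat)"
  shows "c19 (numeral n) = c19 (min (numeral n mod 19) (19 - numeral n mod 19))"
  by (rule c19_min_mod)

lemma c19_mult_reflect:
  assumes "q \<le> 19"
  shows "c19 ((19 - q) * l) = c19 (q * l)"
proof -
  have "2 * pi * real ((19 - q) * l) / 19 = 2 * pi * real l - 2 * pi * real (q * l) / 19"
    using assms by (simp add: of_nat_diff field_simps)
  moreover have "cos (2 * pi * real l) = 1" "sin (2 * pi * real l) = 0"
    using cos_2npi[of l] sin_2npi[of l] by (simp_all add: mult_ac)
  ultimately show ?thesis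
    unfolding c19_def
    by (simp only: cos_diff mult_zero_right mult_1_right mult_1_left mult_zero_left add_0_right)
qed

lemma c19_square: "(c19 j)\<^sup>2 = (1 + c19 (2 * j)) / 2"
  using c19_mult[of j j] by (simp add: power2_eq_square mult_2)

lemma sum_atLeast1_atMost5:
  "(\<Sum>l = 1..(5::nat). f l) = f 1 + f 2 + f 3 + f 4 + (f 5 :: real)"
  by (simp add: numeral_eq_Suc)

lemma c19_bounds:
  "0.94581 \<le> c19 1" "c19 1 \<le> 0.94582"
  "0.78914 \<le> c19 2" "c19 2 \<le> 0.78915"
  "0.54694 \<le> c19 3" "c19 3 \<le> 0.54695"
  "0.24548 \<le> c19 4" "c19 4 \<le> 0.24549"
  "- 0.08258 \<le> c19 5" "c19 5 \<le> - 0.08257"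
  "- 0.40170 \<le> c19 6" "c19 6 \<le> - 0.40169"
  "- 0.67729 \<le> c19 7" "c19 7 \<le> - 0.67728"
  "- 0.87948 \<le> c19 8" "c19 8 \<le> - 0.87947"
  "- 0.98637 \<le> c19 9" "c19 9 \<le> - 0.98636"
proof -
  show "0.94581 \<le> c19 1" "c19 1 \<le> 0.94582"
    using c19_approx(1)[unfolded abs_le_iff] by simp_all
  show "0.78914 \<le> c19 2" "c19 2 \<le> 0.78915"
    using c19_approx(2)[unfolded abs_le_iff] by simp_all
  show "0.54694 \<le> c19 3" "c19 3 \<le> 0.54695"
    using c19_approx(3)[unfolded abs_le_iff] by simp_all
  show "0.24548 \<le> c19 4" "c19 4 \<le> 0.24549"
    using c19_approx(4)[unfolded abs_le_iff] by simp_all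
  show "- 0.08258 \<le> c19 5" "c19 5 \<le> - 0.08257"
    using c19_approx(5)[unfolded abs_le_iff] by simp_all
  show "- 0.40170 \<le> c19 6" "c19 6 \<le> - 0.40169"
    using c19_approx(6)[unfolded abs_le_iff] by simp_all
  show "- 0.67729 \<le> c19 7" "c19 7 \<le> - 0.67728"
    using c19_approx(7)[unfolded abs_le_iff] by simp_all
  show "- 0.87948 \<le> c19 8" "c19 8 \<le> - 0.87947"
    using c19_approx(8)[unfolded abs_le_iff] by simp_all
  show "- 0.98637 \<le> c19 9" "c19 9 \<le> - 0.98636"
    using c19_approx(9)[unfolded abs_le_iff] by simp_all
qed

text \<open>Brings the bounds into the normal form of the simplified goals, so that
  \<open>linarith\<close> sees the same atoms in both.\<close>

lemmas c19_bounds_simplified = c19_bounds[simplified]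

section \<open>Signs of the stability coefficients\<close>

lemma c19_6_neg: "c19 6 < 0"
  using c19_bounds_simplified by linarith

text \<open>The double-angle formula makes these linear in the cosines. They enclose the critical
  density tightly enough for four decimals: (11 + 2 * 0.9965)/19 exceeds 0.6838 and (11 + 2 *
  0.997)/19 is below 0.6839. The upper bound also puts the density below 1, as a fraction
  \<open>d/m\<close> must be.\<close>

lemma c19_threshold_bounds:
  "(c19 6)\<^sup>2 - c19 6 > 0"
  "0.9965 * ((c19 6)\<^sup>2 - c19 6) \<le> (\<Sum>l = 1..5. c19 l - (c19 l)\<^sup>2)"
  "(\<Sum>l = 1..5. c19 l - (c19 l)\<^sup>2) \<le> 0.997 * ((c19 6)\<^sup>2 - c19 6)"
proof -
  show "(c19 6)\<^sup>2 - c19 6 > 0"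
    using c19_bounds_simplified c19_square[of 6] by (simp add: c19_fold)
  show "0.9965 * ((c19 6)\<^sup>2 - c19 6) \<le> (\<Sum>l = 1..5. c19 l - (c19 l)\<^sup>2)"
    "(\<Sum>l = 1..5. c19 l - (c19 l)\<^sup>2) \<le> 0.997 * ((c19 6)\<^sup>2 - c19 6)"
    unfolding sum_atLeast1_atMost5 c19_square
    by (simp add: c19_fold add_divide_distrib numeral_2_eq_2[symmetric]; insert c19_bounds_simplified; linarith)+
qed

text \<open>This is the sum of \<open>intragroup_weight\<close> over all 19 residues: the group
  itself, distances 1 to 5 twice each, and distance 6 twice with its extra factor 2.\<close>

lemma c19_intragroup_pos: "1 + 2 * (\<Sum>l = 1..5. c19 l) + 4 * c19 6 > 0"
  unfolding sum_atLeast1_atMost5 by (simp; insert c19_bounds_simplified; linarith)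

text \<open>Modes \<open>q\<close> and \<open>19 - q\<close> have equal eigenvalues, which leaves
  eight cases; the product-to-sum formula makes each linear in the cosines. Modes 1 and 18 are
  excluded because there the fully joined network is unstable.\<close>

lemma c19_mode_pos_full:
  assumes "q \<in> {2..17}"
  shows "(\<Sum>l = 1..5. c19 l * (1 - c19 (q * l))) + c19 6 * (1 - c19 (q * 6)) > 0"
proof -
  have low: "(\<Sum>l = 1..5. c19 l * (1 - c19 (q * l))) + c19 6 * (1 - c19 (q * 6)) > 0"
    if "q \<in> {2..9}" for q
  proof -
    have e: "c19 l * (1 - c19 (q * l)) = c19 l - (c19 ((q + 1) * l) + c19 ((q - 1) * l)) / 2" for l
      using c19_mult[of l "q * l"] that by (simp add: algebra_simps)
    have "q = 2 \<or> q = 3 \<or> q = 4 \<or> q = 5 \<or> q = 6 \<or> q = 7 \<or> q = 8 \<or> q = 9"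
      using that by auto
    then show ?thesis
      unfolding e sum_atLeast1_atMost5
      by (elim disjE; simp add: c19_fold add_divide_distrib numeral_2_eq_2[symmetric]; insert c19_bounds_simplified; linarith)
  qed
  show ?thesis
  proof (cases "q \<le> 9")
    case False
    then have "19 - q \<in> {2..9}" using assms by auto
    then show ?thesis
      using assms low[of "19 - q"] by (simp add: c19_mult_reflect)
  qed (use assms low in auto)
qed

text \<open>The distance-6 term is nonpositive, so \<open>d = m\<close> is the worst case and
  settles modes 2 to 17. For modes 1 and 18 the claim is \<open>thr\<close> itself.\<close>

lemma c19_mode_pos:
  assumes q: "q \<in> {1..18}" and d: "0 \<le> d" "d \<le> m" and "m > 0"
    and thr: "d * ((c19 6)\<^sup>2 - c19 6) < m * (\<Sum>l = 1..5. c19 l - (c19 l)\<^sup>2)"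
  shows "m * (\<Sum>l = 1..5. c19 l * (1 - c19 (q * l))) + d * (c19 6 * (1 - c19 (q * 6))) > 0"
proof (cases "q \<in> {2..17}")
  case True
  have "c19 6 * (1 - c19 (q * 6)) \<le> 0"
    using c19_6_neg by (intro mult_nonpos_nonneg) (auto simp: c19_def)
  then have "m * (c19 6 * (1 - c19 (q * 6))) \<le> d * (c19 6 * (1 - c19 (q * 6)))"
    using d by (intro mult_right_mono_neg)
  then show ?thesis
    using mult_pos_pos[OF \<open>m > 0\<close> c19_mode_pos_full[OF True]] by (simp add: distrib_left)
next
  case False
  then have "q = 1 \<or> q = 19 - 1" using q by auto
  then have "c19 (q * l) = c19 l" for l
    using c19_mult_reflect[of 1 l] by auto
  then show ?thesis
    using thr by (simp add: right_diff_distrib power2_eq_square)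
qed

section \<open>Circulant quadratic forms\<close>

text \<open>Exactly one residue is congruent to \<open>x\<close>, so the divisibility test acts as a
  discrete delta function.\<close>

lemma sum_periodic_pick:
  fixes g :: "int \<Rightarrow> real"
  assumes "n > 0" and per: "\<And>x. g (x mod int n) = g x"
  shows "(\<Sum>r<n. if int n dvd x - int r then g (int r) else 0) = g x"
proof -
  have "int n dvd x - int r \<longleftrightarrow> r = nat (x mod int n)" if "r < n" for r
  proof -
    have "int n dvd x - int r \<longleftrightarrow> x mod int n = int r mod int n"
      by (simp add: mod_eq_dvd_iff)
    also have "int r mod int n = int r" using that by simp
    finally show ?thesis using \<open>n > 0\<close> by auto
  qed
  then have "(\<Sum>r<n. if int n dvd x - int r then g (int r) else 0)
      = (\<Sum>r<n. if r = nat (x mod int n) then g (int r) else 0)"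
    by (intro sum.cong) auto
  also have "\<dots> = g x"
    using \<open>n > 0\<close> per[of x] by (simp add: nat_less_iff)
  finally show ?thesis .
qed

text \<open>Inserting the delta of \<open>sum_periodic_pick\<close> and exchanging the sums replaces
  an explicit bijection of the residues.\<close>

lemma sum_periodic_reflect:
  fixes g :: "int \<Rightarrow> real"
  assumes "n > 0" and per: "\<And>x. g (x mod int n) = g x"
  shows "(\<Sum>k<n. g (a - int k)) = (\<Sum>r<n. g (int r))"
proof -
  have "(\<Sum>k<n. g (a - int k)) = (\<Sum>k<n. \<Sum>r<n. if int n dvd a - int k - int r then g (int r) else 0)"
    using sum_periodic_pick[of n g] assms by simp
  also have "\<dots> = (\<Sum>r<n. \<Sum>k<n. if int n dvd a - int k - int r then g (int r) else 0)"
    by (rule sum.swap)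
  also have "\<dots> = (\<Sum>r<n. g (int r) * (\<Sum>k<n. if int n dvd (a - int r) - int k then 1 else 0))"
    by (intro sum.cong refl) (simp add: sum_distrib_left if_distrib algebra_simps cong: if_cong)
  also have "\<dots> = (\<Sum>r<n. g (int r))"
    using sum_periodic_pick[of n "\<lambda>_. 1"] \<open>n > 0\<close> by simp
  finally show ?thesis .
qed

lemma sum_periodic_shift:
  fixes g :: "int \<Rightarrow> real"
  assumes "n > 0" and per: "\<And>x. g (x mod int n) = g x"
  shows "(\<Sum>k<n. g (int k + a)) = (\<Sum>r<n. g (int r))"
proof -
  have per': "g (- (x mod int n)) = g (- x)" for x
    using per[of "- x"] per[of "- (x mod int n)"] by (simp add: mod_minus_eq)
  \<comment> \<open>A shift is the composition of two reflections.\<close>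
  have "(\<Sum>k<n. g (int k + a)) = (\<Sum>k<n. g (- (- a - int k)))"
    by (simp add: add.commute)
  also have "\<dots> = (\<Sum>r<n. g (- int r))"
    by (rule sum_periodic_reflect[of n "\<lambda>x. g (- x)", OF \<open>n > 0\<close> per'])
  also have "\<dots> = (\<Sum>r<n. g (int r))"
    using sum_periodic_reflect[of n g 0] assms by simp
  finally show ?thesis .
qed

text \<open>Orthogonality of the characters: the real part of a geometric series in \<open>z\<close>
  with \<open>z ^ n = 1\<close>, which vanishes unless \<open>z = 1\<close>.\<close>

lemma sum_cos_multiples:
  assumes "n > 0"
  shows "(\<Sum>q<n. cos (2 * pi * real q * of_int j / real n)) = (if int n dvd j then real n else 0)"
proof (cases "int n dvd j")
  case True
  then obtain t where t: "j = int n * t" ..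
  have "cos (2 * pi * real q * of_int j / real n) = 1" for q
    using cos_int_2pin[of "int q * t"] \<open>n > 0\<close> by (simp add: t mult_ac)
  then show ?thesis using True by simp
next
  case False
  define z where "z = cis (2 * pi * of_int j / real n)"
  have "z \<noteq> 1"
  proof
    assume "z = 1"
    then have "cos (2 * pi * of_int j / real n) = 1"
      by (simp add: z_def complex_eq_iff)
    then obtain t :: int where "2 * pi * of_int j / real n = of_int t * 2 * pi"
      by (auto simp: cos_one_2pi_int)
    then have "of_int j = (of_int (t * int n) :: real)"
      using \<open>n > 0\<close> by (simp add: field_simps)
    then have "j = t * int n" by (simp only: of_int_eq_iff)
    then show False using False by simp
  qed
  have "real n * (2 * pi * of_int j / real n) = 2 * pi * of_int j"
    using \<open>n > 0\<close> by simp
  then have "z ^ n = cis (2 * pi * of_int j)"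
    by (simp only: z_def Complex.DeMoivre)
  also have "\<dots> = 1"
    using cos_int_2pin[of j] sin_int_2pin[of j] by (simp add: complex_eq_iff)
  finally have "(\<Sum>q<n. z ^ q) = 0"
    using \<open>z \<noteq> 1\<close> geometric_sum[of z n] by simp
  then have "(\<Sum>q<n. Re (z ^ q)) = 0"
    by (simp flip: Re_sum)
  then show ?thesis
    using False by (simp add: z_def Complex.DeMoivre mult_ac)
qed

text \<open>The squared modulus of the discrete Fourier transform, as a real double sum.\<close>

definition dft_power :: "nat \<Rightarrow> (nat \<Rightarrow> real) \<Rightarrow> nat \<Rightarrow> real" where
  "dft_power n u q = (\<Sum>k<n. \<Sum>l<n. u k * u l * cos (2 * pi * real q * of_int (int k - int l) / real n))"

text \<open>The cosine of a difference splits the double sum into the squares of the real and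
  imaginary parts of the transform.\<close>

lemma dft_power_nonneg: "dft_power n u q \<ge> 0"
proof -
  let ?x = "\<lambda>k. 2 * pi * real q * real k / real n"
  have "dft_power n u q = (\<Sum>k<n. u k * cos (?x k))\<^sup>2 + (\<Sum>k<n. u k * sin (?x k))\<^sup>2"
    unfolding dft_power_def power2_eq_square sum_product sum.distrib[symmetric]
    by (intro sum.cong refl) (simp add: right_diff_distrib diff_divide_distrib cos_diff algebra_simps)
  then show ?thesis by simp
qed

text \<open>Parseval's identity for the circulant Laplacian with weights \<open>H\<close>: the inner
  sum over \<open>r\<close> is its eigenvalue on mode \<open>q\<close>. The 2 arises because the
  left side counts every pair in both orders.\<close>

lemma circulant_form_eq_dft:
  fixes H :: "int \<Rightarrow> real"
  assumes "n > 0" and per: "\<And>x. H (x mod int n) = H x" and even: "\<And>x. H (- x) = H x"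
  shows "real n * (\<Sum>k<n. \<Sum>l<n. H (int l - int k) * (u l - u k)\<^sup>2)
    = 2 * (\<Sum>q<n. dft_power n u q * (\<Sum>r<n. H (int r) * (1 - cos (2 * pi * real q * real r / real n))))"
proof -
  define c where "c q x = cos (2 * pi * real q * of_int x / real n)" for q and x :: int
  have orth: "(\<Sum>q<n. c q x) = (if int n dvd x then real n else 0)" for x
    unfolding c_def by (rule sum_cos_multiples[OF \<open>n > 0\<close>])
  have prod: "c q x * c q y = (c q (x - y) + c q (x + y)) / 2" for q x y
    unfolding c_def cos_times_cos by (simp add: algebra_simps add_divide_distrib diff_divide_distrib)
  let ?T = "\<Sum>r<n. H (int r)"
  \<comment> \<open>The inverse transform of the eigenvalues gives back the matrix entries: the
    total weight \<open>?T\<close> on the diagonal, minus \<open>H\<close>.\<close>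
  have inner: "(\<Sum>q<n. \<Sum>r<n. c q x * (H (int r) * (1 - c q (int r))))
      = real n * ((if int n dvd x then ?T else 0) - H x)" for x
  proof -
    have "(\<Sum>q<n. \<Sum>r<n. c q x * (H (int r) * (1 - c q (int r))))
        = (\<Sum>r<n. \<Sum>q<n. c q x * (H (int r) * (1 - c q (int r))))"
      by (rule sum.swap)
    also have "\<dots> = (\<Sum>r<n. H (int r) * ((\<Sum>q<n. c q x) - ((\<Sum>q<n. c q (x - int r)) + (\<Sum>q<n. c q (x + int r))) / 2))"
    proof (intro sum.cong refl)
      fix r
      have "c q x * (1 - c q (int r)) = c q x - (c q (x - int r) + c q (x + int r)) / 2" for q
        by (simp add: right_diff_distrib prod)
      then have eq: "c q x * (H (int r) * (1 - c q (int r))) = H (int r) * (c q x - (c q (x - int r) + c q (x + int r)) / 2)" for q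
        by (metis mult.left_commute)
      show "(\<Sum>q<n. c q x * (H (int r) * (1 - c q (int r))))
        = H (int r) * ((\<Sum>q<n. c q x) - ((\<Sum>q<n. c q (x - int r)) + (\<Sum>q<n. c q (x + int r))) / 2)"
        unfolding eq sum_distrib_left[symmetric] sum_subtractf sum_divide_distrib[symmetric] sum.distrib ..
    qed
    also have "\<dots> = (if int n dvd x then real n else 0) * ?T
        - real n / 2 * (\<Sum>r<n. if int n dvd x - int r then H (int r) else 0)
        - real n / 2 * (\<Sum>r<n. if int n dvd (- x) - int r then H (int r) else 0)"
    proof -
      have "int n dvd (- x) - int r \<longleftrightarrow> int n dvd x + int r" for r
        using dvd_minus_iff[of "int n" "x + int r"] by simp
      then show ?thesis unfolding orth sum_distrib_left sum_subtractf[symmetric]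
        by (intro sum.cong refl) (simp add: field_simps)
    qed
    also have "\<dots> = real n * ((if int n dvd x then ?T else 0) - H x)"
      using sum_periodic_pick[OF \<open>n > 0\<close>, of H, OF per] by (simp add: even algebra_simps)
    finally show ?thesis .
  qed
  have "(\<Sum>q<n. dft_power n u q * (\<Sum>r<n. H (int r) * (1 - c q (int r))))
      = (\<Sum>q<n. \<Sum>k<n. \<Sum>l<n. u k * u l * (\<Sum>r<n. c q (int k - int l) * (H (int r) * (1 - c q (int r)))))"
    unfolding dft_power_def c_def[symmetric]
    by (simp add: sum_distrib_left sum_distrib_right mult_ac)
  also have "\<dots> = (\<Sum>k<n. \<Sum>l<n. u k * u l * (\<Sum>q<n. \<Sum>r<n. c q (int k - int l) * (H (int r) * (1 - c q (int r)))))"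
    unfolding sum_distrib_left
    by (rule trans[OF sum.swap]) (intro sum.cong refl sum.swap)
  also have "\<dots> = (\<Sum>k<n. \<Sum>l<n. real n * (if l = k then u k * u k * ?T else 0) - real n * (H (int l - int k) * u k * u l))"
  proof (unfold inner, intro sum.cong refl)
    fix k l assume "k \<in> {..<n}" "l \<in> {..<n}"
    then have "int n dvd int k - int l \<longleftrightarrow> l = k"
      using mod_eq_dvd_iff[of "int k" "int n" "int l"] by auto
    moreover have "H (int k - int l) = H (int l - int k)"
      using even[of "int k - int l"] by simp
    ultimately show "u k * u l * (real n * ((if int n dvd int k - int l then ?T else 0) - H (int k - int l)))
       = real n * (if l = k then u k * u k * ?T else 0) - real n * (H (int l - int k) * u k * u l)"
      by (simp add: algebra_simps)
  qed
  also have "\<dots> = real n * (\<Sum>k<n. u k * u k * ?T) - real n * (\<Sum>k<n. \<Sum>l<n. H (int l - int k) * u k * u l)"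
    by (simp add: sum_subtractf flip: sum_distrib_left)
  finally have dft: "(\<Sum>q<n. dft_power n u q * (\<Sum>r<n. H (int r) * (1 - c q (int r)))) = \<dots>" .
  have "(\<Sum>l<n. H (int l - int k) * (u k)\<^sup>2) = u k * u k * ?T" for k
    using sum_periodic_shift[OF \<open>n > 0\<close>, of H "- int k", OF per]
    by (simp add: power2_eq_square flip: sum_distrib_right)
  then have "(\<Sum>k<n. \<Sum>l<n. H (int l - int k) * (u k)\<^sup>2) = (\<Sum>k<n. u k * u k * ?T)"
    by simp
  moreover have "(\<Sum>k<n. \<Sum>l<n. H (int l - int k) * (u l)\<^sup>2) = (\<Sum>k<n. \<Sum>l<n. H (int l - int k) * (u k)\<^sup>2)"
  proof (rule trans[OF sum.swap], intro sum.cong refl)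
    fix k l
    show "H (int k - int l) * (u k)\<^sup>2 = H (int l - int k) * (u k)\<^sup>2"
      using even[of "int l - int k"] by simp
  qed
  moreover have "(\<Sum>k<n. \<Sum>l<n. H (int l - int k) * (u l - u k)\<^sup>2)
      = (\<Sum>k<n. \<Sum>l<n. H (int l - int k) * (u l)\<^sup>2) + (\<Sum>k<n. \<Sum>l<n. H (int l - int k) * (u k)\<^sup>2)
        - 2 * (\<Sum>k<n. \<Sum>l<n. H (int l - int k) * u k * u l)"
    unfolding sum_distrib_left sum.distrib[symmetric] sum_subtractf[symmetric]
    by (intro sum.cong refl) (simp add: power2_eq_square algebra_simps)
  ultimately have "(\<Sum>k<n. \<Sum>l<n. H (int l - int k) * (u l - u k)\<^sup>2)
      = 2 * ((\<Sum>k<n. u k * u k * ?T) - (\<Sum>k<n. \<Sum>l<n. H (int l - int k) * u k * u l))"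
    by simp
  then have "real n * (\<Sum>k<n. \<Sum>l<n. H (int l - int k) * (u l - u k)\<^sup>2)
      = 2 * (\<Sum>q<n. dft_power n u q * (\<Sum>r<n. H (int r) * (1 - c q (int r))))"
    unfolding dft by (simp only: right_diff_distrib mult.left_commute)
  then show ?thesis
    by (simp add: c_def)
qed

text \<open>The form with weights \<open>H\<close> and the one with constant weights are diagonal in
  the same Fourier basis, so they can be compared mode by mode. Mode 0 contributes 0 to
  both.\<close>

lemma circulant_form_coercive:
  fixes H :: "int \<Rightarrow> real"
  assumes "n > 0" and per: "\<And>x. H (x mod int n) = H x" and even: "\<And>x. H (- x) = H x"
    and pos: "\<And>q. 0 < q \<Longrightarrow> q < n \<Longrightarrow> (\<Sum>r<n. H (int r) * (1 - cos (2 * pi * real q * real r / real n))) > 0"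
  obtains c where "c > 0"
    "\<And>u. c * (\<Sum>k<n. \<Sum>l<n. (u l - u k)\<^sup>2) \<le> (\<Sum>k<n. \<Sum>l<n. H (int l - int k) * (u l - u k)\<^sup>2)"
proof
  define M where "M K q = (\<Sum>r<n. K (int r) * (1 - cos (2 * pi * real q * real r / real n)))"
    for K :: "int \<Rightarrow> real" and q
  \<comment> \<open>\<open>2 * real n\<close> bounds the eigenvalues for constant weights, as each
    \<open>1 - cos\<close> is at most 2. Inserting 1 keeps the minimum over a nonempty set when
    \<open>n = 1\<close>.\<close>
  define c where "c = Min (insert 1 (M H ` {0<..<n})) / (2 * real n)"
  show "c > 0"
    using pos \<open>n > 0\<close> by (auto simp: c_def M_def)
  have mode: "c * M (\<lambda>_. 1) q \<le> M H q" if "q < n" for q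
  proof (cases "q = 0")
    case False
    have "M (\<lambda>_. 1) q \<le> (\<Sum>r<n. 2)"
    proof (unfold M_def, rule sum_mono)
      have "1 - cos x \<le> 2" for x :: real
        using cos_ge_minus_one[of x] by linarith
      then show "1 * (1 - cos (2 * pi * real q * real r / real n)) \<le> 2" for r
        by (simp only: mult_1_left)
    qed
    then have "c * M (\<lambda>_. 1) q \<le> c * (2 * real n)"
      using \<open>c > 0\<close> by (intro mult_left_mono) auto
    also have "\<dots> = Min (insert 1 (M H ` {0<..<n}))"
      using \<open>n > 0\<close> by (simp add: c_def)
    also have "\<dots> \<le> M H q"
      using False that by (intro Min_le) auto
    finally show ?thesis .
  qed (simp add: M_def)
  fix u :: "nat \<Rightarrow> real"
  have "real n * (c * (\<Sum>k<n. \<Sum>l<n. (u l - u k)\<^sup>2)) = 2 * (\<Sum>q<n. dft_power n u q * (c * M (\<lambda>_. 1) q))"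
  proof -
    have "real n * (\<Sum>k<n. \<Sum>l<n. (u l - u k)\<^sup>2) = 2 * (\<Sum>q<n. dft_power n u q * M (\<lambda>_. 1) q)"
      using circulant_form_eq_dft[OF \<open>n > 0\<close>, of "\<lambda>_. 1" u] by (simp add: M_def)
    then have "c * (real n * (\<Sum>k<n. \<Sum>l<n. (u l - u k)\<^sup>2)) = c * (2 * (\<Sum>q<n. dft_power n u q * M (\<lambda>_. 1) q))"
      by simp
    also have "\<dots> = 2 * (\<Sum>q<n. dft_power n u q * (c * M (\<lambda>_. 1) q))"
      by (simp add: sum_distrib_left mult_ac)
    finally show ?thesis by (simp only: mult.left_commute)
  qed
  also have "\<dots> \<le> 2 * (\<Sum>q<n. dft_power n u q * M H q)"
    by (intro mult_left_mono sum_mono mode dft_power_nonneg) auto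
  also have "\<dots> = real n * (\<Sum>k<n. \<Sum>l<n. H (int l - int k) * (u l - u k)\<^sup>2)"
    unfolding M_def by (rule circulant_form_eq_dft[OF \<open>n > 0\<close> per even, symmetric])
  finally show "c * (\<Sum>k<n. \<Sum>l<n. (u l - u k)\<^sup>2) \<le> (\<Sum>k<n. \<Sum>l<n. H (int l - int k) * (u l - u k)\<^sup>2)"
    using \<open>n > 0\<close> by simp
qed

section \<open>Forms on groups of nodes\<close>

lemma sum_lessThan_mult_eq:
  fixes f :: "nat \<Rightarrow> 'a::comm_monoid_add"
  shows "(\<Sum>i<n * m. f i) = (\<Sum>k<n. \<Sum>s<m. f (k + n * s))"
proof -
  have "(\<Sum>k<n. \<Sum>s<m. f (k + n * s)) = (\<Sum>(k, s)\<in>{..<n} \<times> {..<m}. f (k + n * s))"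
    by (rule sum.cartesian_product)
  also have "\<dots> = (\<Sum>i<n * m. f i)"
  proof (rule sum.reindex_bij_witness[where i = "\<lambda>i. (i mod n, i div n)" and j = "\<lambda>(k, s). k + n * s"])
    fix p assume "p \<in> {..<n} \<times> {..<m}"
    then obtain k s where p: "p = (k, s)" "k < n" "s < m" by auto
    have "k + n * s < n * Suc s" using p by simp
    also have "\<dots> \<le> n * m" using p by (intro mult_le_mono2) auto
    finally show "(case p of (k, s) \<Rightarrow> k + n * s) \<in> {..<n * m}" by (simp add: p)
  next
    fix i assume "i \<in> {..<n * m}"
    then show "(i mod n, i div n) \<in> {..<n} \<times> {..<m}"
      by (cases "n = 0") (auto simp: less_mult_imp_div_less mult.commute)
  qed auto
  finally show ?thesis ..
qed

text \<open>With \<open>a\<close> and \<open>b\<close> the means of \<open>x\<close> and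
  \<open>y\<close>, the terms mixing \<open>b - a\<close> with a deviation vanish: constant row and
  column sums reduce them to multiples of the sums of deviations.\<close>

lemma regular_bipartite_form:
  fixes x y :: "nat \<Rightarrow> real"
  assumes rows: "\<And>s. s < m \<Longrightarrow> (\<Sum>t<m. B s t) = D" and cols: "\<And>t. t < m \<Longrightarrow> (\<Sum>s<m. B s t) = D"
    and x: "(\<Sum>s<m. x s - a) = 0" and y: "(\<Sum>s<m. y s - b) = 0"
  shows "(\<Sum>s<m. \<Sum>t<m. B s t * (y t - x s)\<^sup>2)
    = real m * D * (b - a)\<^sup>2 + (\<Sum>s<m. \<Sum>t<m. B s t * ((y t - b) - (x s - a))\<^sup>2)"
proof -
  have "(\<Sum>s<m. \<Sum>t<m. B s t * (x s - a)) = (\<Sum>s<m. D * (x s - a))"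
    using rows by (simp flip: sum_distrib_right)
  then have X: "(\<Sum>s<m. \<Sum>t<m. B s t * (x s - a)) = 0"
    using x by (simp flip: sum_distrib_left)
  have "(\<Sum>s<m. \<Sum>t<m. B s t * (y t - b)) = (\<Sum>t<m. \<Sum>s<m. B s t * (y t - b))"
    by (rule sum.swap)
  also have "\<dots> = (\<Sum>t<m. D * (y t - b))"
    using cols by (simp flip: sum_distrib_right)
  finally have Y: "(\<Sum>s<m. \<Sum>t<m. B s t * (y t - b)) = 0"
    using y by (simp flip: sum_distrib_left)
  have "(\<Sum>s<m. \<Sum>t<m. B s t * (y t - x s)\<^sup>2)
      = (\<Sum>s<m. \<Sum>t<m. (b - a)\<^sup>2 * B s t + 2 * (b - a) * (B s t * (y t - b))
          - 2 * (b - a) * (B s t * (x s - a)) + B s t * ((y t - b) - (x s - a))\<^sup>2)"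
    by (intro sum.cong refl) (simp add: power2_eq_square algebra_simps)
  also have "\<dots> = (b - a)\<^sup>2 * (\<Sum>s<m. \<Sum>t<m. B s t) + 2 * (b - a) * (\<Sum>s<m. \<Sum>t<m. B s t * (y t - b))
        - 2 * (b - a) * (\<Sum>s<m. \<Sum>t<m. B s t * (x s - a))
        + (\<Sum>s<m. \<Sum>t<m. B s t * ((y t - b) - (x s - a))\<^sup>2)"
    by (simp only: sum.distrib sum_subtractf sum_distrib_left)
  also have "(\<Sum>s<m. \<Sum>t<m. B s t) = real m * D"
    using rows by simp
  finally show ?thesis
    by (simp only: X Y) simp
qed

lemma regular_bipartite_form_le:
  fixes x y :: "nat \<Rightarrow> real"
  assumes rows: "\<And>s. s < m \<Longrightarrow> (\<Sum>t<m. B s t) = D" and cols: "\<And>t. t < m \<Longrightarrow> (\<Sum>s<m. B s t) = D"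
    and nonneg: "\<And>s t. B s t \<ge> 0"
  shows "(\<Sum>s<m. \<Sum>t<m. B s t * (y t - x s)\<^sup>2) \<le> 2 * D * ((\<Sum>s<m. (x s)\<^sup>2) + (\<Sum>s<m. (y s)\<^sup>2))"
proof -
  have sq: "(p - q)\<^sup>2 \<le> 2 * q\<^sup>2 + 2 * p\<^sup>2" for p q :: real
    using zero_le_power2[of "p + q"] by (simp add: power2_sum power2_diff)
  have "B s t * (y t - x s)\<^sup>2 \<le> B s t * (2 * (x s)\<^sup>2) + B s t * (2 * (y t)\<^sup>2)" for s t
    using mult_left_mono[OF sq nonneg[of s t]] by (simp add: distrib_left)
  then have "(\<Sum>s<m. \<Sum>t<m. B s t * (y t - x s)\<^sup>2)
      \<le> (\<Sum>s<m. \<Sum>t<m. B s t * (2 * (x s)\<^sup>2) + B s t * (2 * (y t)\<^sup>2))"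
    by (intro sum_mono)
  also have "\<dots> = (\<Sum>s<m. \<Sum>t<m. B s t * (2 * (x s)\<^sup>2)) + (\<Sum>s<m. \<Sum>t<m. B s t * (2 * (y t)\<^sup>2))"
    by (simp only: sum.distrib)
  also have "(\<Sum>s<m. \<Sum>t<m. B s t * (2 * (y t)\<^sup>2)) = (\<Sum>t<m. \<Sum>s<m. B s t * (2 * (y t)\<^sup>2))"
    by (rule sum.swap)
  also have "\<dots> = 2 * D * (\<Sum>s<m. (y s)\<^sup>2)"
    using cols by (simp add: sum_distrib_left mult_ac flip: sum_distrib_right)
  also have "(\<Sum>s<m. \<Sum>t<m. B s t * (2 * (x s)\<^sup>2)) = 2 * D * (\<Sum>s<m. (x s)\<^sup>2)"
    using rows by (simp add: sum_distrib_left mult_ac flip: sum_distrib_right)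
  finally show ?thesis by (simp add: distrib_left)
qed

lemma sum_sum_diff_square:
  fixes x y :: "nat \<Rightarrow> real"
  assumes "(\<Sum>s<m. x s) = 0"
  shows "(\<Sum>s<m. \<Sum>t<m. (y t - x s)\<^sup>2) = real m * ((\<Sum>s<m. (x s)\<^sup>2) + (\<Sum>s<m. (y s)\<^sup>2))"
proof -
  have "(\<Sum>s<m. \<Sum>t<m. (y t - x s)\<^sup>2) = (\<Sum>s<m. \<Sum>t<m. (y t)\<^sup>2 + (x s)\<^sup>2 - x s * (2 * y t))"
    by (intro sum.cong refl) (simp add: power2_diff)
  also have "\<dots> = (\<Sum>s<m. \<Sum>t<m. (y t)\<^sup>2) + (\<Sum>s<m. \<Sum>t<m. (x s)\<^sup>2) - (\<Sum>s<m. x s) * (\<Sum>t<m. 2 * y t)"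
    by (simp only: sum.distrib sum_subtractf sum_product)
  finally show ?thesis
    using assms by (simp add: distrib_left sum_distrib_left)
qed

section \<open>The network\<close>

text \<open>Residue 0 is included, so each group is a clique once \<open>blowup\<close> removes the
  loops.\<close>

definition near :: "int \<Rightarrow> bool" where
  "near r \<longleftrightarrow> r mod 19 \<le> 5 \<or> 14 \<le> r mod 19"

definition far :: "int \<Rightarrow> bool" where
  "far r \<longleftrightarrow> r mod 19 = 6 \<or> r mod 19 = 13"

text \<open>
  Between two groups at distance 6, testing the sum \<open>s + t\<close> (not the difference) makes the
  bipartite graph symmetric in the two groups as well as \<open>d\<close>-regular.
\<close>

definition link :: "nat \<Rightarrow> nat \<Rightarrow> int \<Rightarrow> nat \<Rightarrow> nat \<Rightarrow> real" where
  "link m d r s t = (if near r \<or> far r \<and> (s + t) mod m < d then 1 else 0)"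

text \<open>Node \<open>i\<close> is number \<open>i div 19\<close> of group \<open>i mod 19\<close>.\<close>

definition blowup :: "nat \<Rightarrow> nat \<Rightarrow> nat \<Rightarrow> nat \<Rightarrow> real" where
  "blowup m d i j = (if i = j then 0 else link m d (int (j mod 19) - int (i mod 19)) (i div 19) (j div 19))"

definition link_degree :: "nat \<Rightarrow> nat \<Rightarrow> int \<Rightarrow> real" where
  "link_degree m d r = (if near r then real m else if far r then real d else 0)"

abbreviation C19 :: "int \<Rightarrow> real" where
  "C19 r \<equiv> cos (2 * pi * of_int r / 19)"

lemma near_uminus [simp]: "near (- r) = near r"
  by (auto simp: near_def zmod_zminus1_eq_if)

lemma far_uminus [simp]: "far (- r) = far r"
  by (auto simp: far_def zmod_zminus1_eq_if)

lemma near_mod [simp]: "near (r mod 19) = near r"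
  and far_mod [simp]: "far (r mod 19) = far r"
  by (simp_all add: near_def far_def)

lemma near_not_far: "near r \<Longrightarrow> \<not> far r"
  by (auto simp: near_def far_def)

lemma link_01: "link m d r s t \<in> {0, 1}"
  by (simp add: link_def)

text \<open>For fixed \<open>s\<close>, \<open>(s + t) mod m\<close> runs once through all residues
  as \<open>t\<close> does, and \<open>d\<close> of them are below \<open>d\<close>. Columns follow
  as \<open>s + t\<close> is symmetric.\<close>

lemma sum_link:
  assumes "m > 0" "d \<le> m"
  shows "(\<Sum>t<m. link m d r s t) = link_degree m d r" "(\<Sum>s<m. link m d r s t) = link_degree m d r"
proof -
  have count: "(\<Sum>t<m. if (s + t) mod m < d then 1 else 0) = real d" for s
  proof -
    define g :: "int \<Rightarrow> real" where "g x = (if x mod int m < int d then 1 else 0)" for x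
    have "(\<Sum>t<m. if (s + t) mod m < d then 1 else 0) = (\<Sum>t<m. g (int t + int s))"
      by (intro sum.cong refl) (simp add: g_def add.commute flip: of_nat_add of_nat_mod)
    also have "\<dots> = (\<Sum>r<m. g (int r))"
      by (rule sum_periodic_shift) (use assms in \<open>simp_all add: g_def\<close>)
    also have "\<dots> = (\<Sum>r<m. if r < d then 1 else 0)"
      by (intro sum.cong refl) (simp add: g_def flip: of_nat_mod)
    also have "\<dots> = real (card {r \<in> {..<m}. r < d})"
      by (simp add: sum.If_cases Int_def)
    also have "{r \<in> {..<m}. r < d} = {..<d}"
      using assms by auto
    finally show ?thesis by simp
  qed
  show row: "(\<Sum>t<m. link m d r s t) = link_degree m d r" for s
    using count[of s] by (auto simp: link_def link_degree_def near_not_far cong: if_cong)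
  show "(\<Sum>s<m. link m d r s t) = link_degree m d r"
    using row[of t] by (simp add: link_def add.commute)
qed

lemma C19_mod [simp]: "C19 (r mod 19) = C19 r"
  and S19_mod [simp]: "sin (2 * pi * of_int (r mod 19) / 19) = sin (2 * pi * of_int r / 19)"
proof -
  have "real_of_int r = of_int (r mod 19) + 19 * of_int (r div 19)"
    by (metis mod_mult_div_eq of_int_add of_int_mult of_int_numeral)
  then have *: "2 * pi * of_int r / 19 = 2 * pi * of_int (r mod 19) / 19 + 2 * pi * of_int (r div 19)"
    by (simp add: field_simps)
  show "C19 (r mod 19) = C19 r" "sin (2 * pi * of_int (r mod 19) / 19) = sin (2 * pi * of_int r / 19)"
    unfolding * by (simp_all only: cos_add sin_add cos_int_2pin sin_int_2pin mult_1_right mult_zero_right mult_1_left add_0_right diff_0_right)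
qed

lemma C19_c19: "C19 (int r) = c19 r"
  by (simp add: c19_def)

lemma C19_far:
  assumes "far r"
  shows "C19 r < 0"
proof -
  have "r mod 19 = int 6 \<or> r mod 19 = int 13"
    using assms by (simp add: far_def)
  then have "C19 (r mod 19) = c19 6 \<or> C19 (r mod 19) = c19 13"
    by (metis C19_c19)
  then have "C19 r = c19 6"
    using c19_reflect[of 6] by simp
  then show ?thesis using c19_6_neg by simp
qed

text \<open>
  The factor 2 is the bound \<open>(p - q)\<^sup>2 \<le> 2 p\<^sup>2 + 2 q\<^sup>2\<close> for the distance-6 edges, whose cosine is
  negative.
\<close>

definition intragroup_weight :: "int \<Rightarrow> real" where
  "intragroup_weight r = (if near r then C19 r else if far r then 2 * C19 r else 0)"

text \<open>For near pairs the deviation part is exact. For far pairs the cosine is negative, so an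
  upper bound on the unweighted deviations gives a lower bound; \<open>d \<le> m\<close> then makes
  the weight independent of \<open>d\<close>.\<close>

lemma group_pair_form_ge:
  fixes x y :: "nat \<Rightarrow> real"
  assumes "m > 0" "d \<le> m" and x: "(\<Sum>s<m. x s - a) = 0" and y: "(\<Sum>s<m. y s - b) = 0"
  shows "real m * (C19 r * link_degree m d r * (b - a)\<^sup>2)
      + real m * (intragroup_weight r * ((\<Sum>s<m. (x s - a)\<^sup>2) + (\<Sum>s<m. (y s - b)\<^sup>2)))
    \<le> (\<Sum>s<m. \<Sum>t<m. link m d r s t * C19 r * (y t - x s)\<^sup>2)"
proof -
  let ?L = "link m d r" and ?D = "link_degree m d r"
  let ?W = "(\<Sum>s<m. (x s - a)\<^sup>2) + (\<Sum>s<m. (y s - b)\<^sup>2)"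
  define R where "R = (\<Sum>s<m. \<Sum>t<m. ?L s t * ((y t - b) - (x s - a))\<^sup>2)"
  have "(\<Sum>s<m. \<Sum>t<m. ?L s t * (y t - x s)\<^sup>2) = real m * ?D * (b - a)\<^sup>2 + R"
    unfolding R_def by (rule regular_bipartite_form[OF sum_link[OF assms(1,2)] x y])
  moreover have "(\<Sum>s<m. \<Sum>t<m. ?L s t * C19 r * (y t - x s)\<^sup>2) = C19 r * (\<Sum>s<m. \<Sum>t<m. ?L s t * (y t - x s)\<^sup>2)"
    by (simp add: sum_distrib_left mult_ac)
  ultimately have total: "(\<Sum>s<m. \<Sum>t<m. ?L s t * C19 r * (y t - x s)\<^sup>2) = real m * (C19 r * ?D * (b - a)\<^sup>2) + C19 r * R"
    by (simp add: distrib_left mult_ac)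
  have "real m * (intragroup_weight r * ?W) \<le> C19 r * R"
  proof -
    consider (near) "near r" | (far) "far r" "\<not> near r" | (neither) "\<not> near r" "\<not> far r" by blast
    then show ?thesis
    proof cases
      case near
      then have "R = real m * ?W"
        unfolding R_def using sum_sum_diff_square[OF x] by (simp add: link_def)
      then show ?thesis using near by (simp add: intragroup_weight_def)
    next
      case far
      have "0 \<le> ?W" by (intro add_nonneg_nonneg sum_nonneg) auto
      have "R \<le> 2 * ?D * ?W"
        unfolding R_def by (rule regular_bipartite_form_le[OF sum_link[OF assms(1,2)]]) (simp add: link_def)
      also have "\<dots> \<le> 2 * real m * ?W"
        using far \<open>d \<le> m\<close> \<open>0 \<le> ?W\<close> by (intro mult_right_mono) (auto simp: link_degree_def)
      finally have "C19 r * (2 * real m * ?W) \<le> C19 r * R"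
        using C19_far[OF far(1)] by (intro mult_left_mono_neg) auto
      then show ?thesis using far by (simp add: intragroup_weight_def algebra_simps)
    next
      case neither
      then show ?thesis by (simp add: intragroup_weight_def R_def link_def)
    qed
  qed
  then show ?thesis unfolding total by simp
qed

lemma intragroup_weight_sum_pos: "(\<Sum>r<19. intragroup_weight (int r)) > 0"
proof -
  have "(\<Sum>r<19. intragroup_weight (int r)) = 1 + 2 * (\<Sum>l = 1..5. c19 l) + 4 * c19 6"
    unfolding intragroup_weight_def C19_c19 sum_atLeast1_atMost5
    by (simp add: lessThan_nat_numeral lessThan_Suc near_def far_def c19_fold)
  then show ?thesis using c19_intragroup_pos by simp
qed

text \<open>Residues \<open>r\<close> and \<open>19 - r\<close> contribute equally and residue 0
  contributes nothing, so the eigenvalue is twice the expression in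
  \<open>c19_mode_pos\<close>.\<close>

lemma group_mode_pos:
  assumes "0 < q" "q < 19" "m > 0" "d \<le> m"
    and thr: "real d * ((c19 6)\<^sup>2 - c19 6) < real m * (\<Sum>l = 1..5. c19 l - (c19 l)\<^sup>2)"
  shows "(\<Sum>r<19. C19 (int r) * link_degree m d (int r) * (1 - cos (2 * pi * real q * real r / real 19))) > 0"
proof -
  have "cos (2 * pi * real q * real r / real 19) = c19 (q * r)" for r
    by (simp add: c19_def mult.assoc)
  moreover have "c19 (q * 14) = c19 (q * 5)" "c19 (q * 15) = c19 (q * 4)" "c19 (q * 16) = c19 (q * 3)"
    "c19 (q * 17) = c19 (q * 2)" "c19 (q * 18) = c19 q" "c19 (q * 13) = c19 (q * 6)"
    using c19_mult_reflect[of 5 q] c19_mult_reflect[of 4 q] c19_mult_reflect[of 3 q]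
      c19_mult_reflect[of 2 q] c19_mult_reflect[of 1 q] c19_mult_reflect[of 6 q]
    by (simp_all add: mult.commute)
  ultimately have "(\<Sum>r<19. C19 (int r) * link_degree m d (int r) * (1 - cos (2 * pi * real q * real r / real 19)))
     = 2 * (m * (\<Sum>l = 1..5. c19 l * (1 - c19 (q * l))) + d * (c19 6 * (1 - c19 (q * 6))))"
    unfolding C19_c19 sum_atLeast1_atMost5
    by (simp add: lessThan_nat_numeral lessThan_Suc near_def far_def c19_fold link_degree_def algebra_simps)
  then show ?thesis
    using c19_mode_pos[of q "real d" "real m"] assms by simp
qed

text \<open>\<open>blowup\<close> and \<open>link\<close> differ only on the diagonal, where
  \<open>F\<close> vanishes; without the exception the sum runs over groups and members
  separately.\<close>

lemma blowup_sum:
  assumes "F i i = 0"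
  shows "(\<Sum>j<19 * m. blowup m d i j * F i j)
    = (\<Sum>l<19. \<Sum>t<m. link m d (int l - int (i mod 19)) (i div 19) t * F i (l + 19 * t))"
proof -
  have "(\<Sum>j<19 * m. blowup m d i j * F i j)
      = (\<Sum>j<19 * m. link m d (int (j mod 19) - int (i mod 19)) (i div 19) (j div 19) * F i j)"
    using assms by (intro sum.cong) (auto simp: blowup_def)
  then show ?thesis by (simp add: sum_lessThan_mult_eq)
qed

lemma blowup_coercive:
  assumes "m > 0" "d \<le> m"
    and thr: "real d * ((c19 6)\<^sup>2 - c19 6) < real m * (\<Sum>l = 1..5. c19 l - (c19 l)\<^sup>2)"
  obtains c where "c > 0"
    "\<And>\<delta>. c * (\<Sum>i<19 * m. \<Sum>j<19 * m. (\<delta> j - \<delta> i)\<^sup>2)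
      \<le> (\<Sum>i<19 * m. \<Sum>j<19 * m. blowup m d i j * C19 (int (j mod 19) - int (i mod 19)) * (\<delta> j - \<delta> i)\<^sup>2)"
proof -
  define H where "H r = C19 r * link_degree m d r" for r
  obtain c1 where "c1 > 0" and c1: "\<And>u. c1 * (\<Sum>k<19. \<Sum>l<19. (u l - u k)\<^sup>2)
      \<le> (\<Sum>k<19. \<Sum>l<19. H (int l - int k) * (u l - u k)\<^sup>2)"
  proof (rule circulant_form_coercive[of 19 H])
    show "H (x mod int 19) = H x" "H (- x) = H x" for x
      by (simp_all add: H_def link_degree_def)
    show "(\<Sum>r<19. H (int r) * (1 - cos (2 * pi * real q * real r / real 19))) > 0"
      if "0 < q" "q < 19" for q
      unfolding H_def by (rule group_mode_pos[OF that assms])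
  qed (use that in auto)
  define \<kappa> where "\<kappa> = (\<Sum>r<19. intragroup_weight (int r))"
  have "\<kappa> > 0" unfolding \<kappa>_def by (rule intragroup_weight_sum_pos)
  \<comment> \<open>With \<open>U\<close> for the means and \<open>W\<close> for the deviations, the
    all-pairs form is \<open>m\<^sup>2 * U\<close> plus 38 m times the sum of \<open>W\<close>,
    while the weighted form is at least \<open>m * c1 * U\<close> plus
    \<open>2 * m * \<kappa>\<close> times that sum. The two entries of the minimum compare these
    coefficients.\<close>
  define c where "c = min (c1 / real m) (\<kappa> / 19)"
  have "c > 0" using \<open>c1 > 0\<close> \<open>\<kappa> > 0\<close> \<open>m > 0\<close> by (simp add: c_def)
  have cc: "c * (real m)\<^sup>2 \<le> real m * c1" "c * 19 \<le> \<kappa>"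
    using \<open>m > 0\<close> by (auto simp: c_def min_def power2_eq_square field_simps split: if_splits)
  have weight_row: "(\<Sum>l<19. intragroup_weight (int l + a)) = \<kappa>" for a
    unfolding \<kappa>_def by (rule sum_periodic_shift) (simp_all add: intragroup_weight_def)
  have weight_col: "(\<Sum>k<19. intragroup_weight (a - int k)) = \<kappa>" for a
    unfolding \<kappa>_def by (rule sum_periodic_reflect) (simp_all add: intragroup_weight_def)
  show thesis
  proof (rule that[OF \<open>c > 0\<close>])
    fix \<delta> :: "nat \<Rightarrow> real"
    define u where "u k = (\<Sum>s<m. \<delta> (k + 19 * s)) / real m" for k
    define W where "W k = (\<Sum>s<m. (\<delta> (k + 19 * s) - u k)\<^sup>2)" for k
    define U where "U = (\<Sum>k<19. \<Sum>l<19. (u l - u k)\<^sup>2)"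
    have mean: "(\<Sum>s<m. \<delta> (k + 19 * s) - u k) = 0" for k
      using \<open>m > 0\<close> by (simp add: sum_subtractf u_def)
    have "W k \<ge> 0" for k by (auto simp: W_def intro: sum_nonneg)
    then have Wpos: "(\<Sum>k<19. W k) \<ge> 0" by (auto intro: sum_nonneg)
    have "U \<ge> 0" unfolding U_def by (intro sum_nonneg) auto
    have "(\<Sum>i<19 * m. \<Sum>j<19 * m. (\<delta> j - \<delta> i)\<^sup>2)
        = (\<Sum>k<19. \<Sum>l<19. \<Sum>s<m. \<Sum>t<m. (\<delta> (l + 19 * t) - \<delta> (k + 19 * s))\<^sup>2)"
      unfolding sum_lessThan_mult_eq by (rule sum.cong[OF refl], rule sum.swap)
    also have "\<dots> = (\<Sum>k<19. \<Sum>l<19. (real m)\<^sup>2 * (u l - u k)\<^sup>2 + real m * W k + real m * W l)"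
    proof (intro sum.cong refl)
      fix k l
      show "(\<Sum>s<m. \<Sum>t<m. (\<delta> (l + 19 * t) - \<delta> (k + 19 * s))\<^sup>2)
          = (real m)\<^sup>2 * (u l - u k)\<^sup>2 + real m * W k + real m * W l"
        using regular_bipartite_form[of m "\<lambda>_ _. 1" "real m", OF _ _ mean[of k] mean[of l]]
          sum_sum_diff_square[OF mean[of k], of "\<lambda>t. \<delta> (l + 19 * t) - u l"]
        by (simp add: W_def power2_eq_square distrib_left)
    qed
    also have "\<dots> = (real m)\<^sup>2 * U + 38 * real m * (\<Sum>k<19. W k)"
      by (simp add: U_def sum.distrib flip: sum_distrib_left)
    finally have "c * (\<Sum>i<19 * m. \<Sum>j<19 * m. (\<delta> j - \<delta> i)\<^sup>2)
        = (c * (real m)\<^sup>2) * U + (c * 19) * (2 * real m * (\<Sum>k<19. W k))"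
      by (simp add: algebra_simps)
    also have "\<dots> \<le> (real m * c1) * U + \<kappa> * (2 * real m * (\<Sum>k<19. W k))"
      using cc \<open>U \<ge> 0\<close> Wpos by (intro add_mono mult_right_mono) auto
    also have "\<dots> \<le> real m * (\<Sum>k<19. \<Sum>l<19. H (int l - int k) * (u l - u k)\<^sup>2) + \<kappa> * (2 * real m * (\<Sum>k<19. W k))"
      using mult_left_mono[OF c1[of u], of "real m"] by (simp add: U_def mult_ac)
    also have "\<kappa> * (2 * real m * (\<Sum>k<19. W k)) = real m * (\<Sum>k<19. \<Sum>l<19. intragroup_weight (int l - int k) * (W k + W l))"
    proof -
      have "(\<Sum>k<19. \<Sum>l<19. intragroup_weight (int l - int k) * W k) = (\<Sum>k<19. \<kappa> * W k)"
        using weight_row[of "- int k" for k] by (simp flip: sum_distrib_right)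
      moreover have "(\<Sum>k<19. \<Sum>l<19. intragroup_weight (int l - int k) * W l) = (\<Sum>l<19. \<kappa> * W l)"
        using weight_col by (subst sum.swap) (simp flip: sum_distrib_right)
      ultimately show ?thesis
        by (simp add: distrib_left sum.distrib flip: sum_distrib_left)
    qed
    also have "real m * (\<Sum>k<19. \<Sum>l<19. H (int l - int k) * (u l - u k)\<^sup>2) + real m * (\<Sum>k<19. \<Sum>l<19. intragroup_weight (int l - int k) * (W k + W l))
       = (\<Sum>k<19. \<Sum>l<19. real m * (C19 (int l - int k) * link_degree m d (int l - int k) * (u l - u k)\<^sup>2)
            + real m * (intragroup_weight (int l - int k) * (W k + W l)))"
      by (simp only: sum_distrib_left sum.distrib H_def)
    also have "\<dots> \<le> (\<Sum>k<19. \<Sum>l<19. \<Sum>s<m. \<Sum>t<m. link m d (int l - int k) s t * C19 (int l - int k)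
          * (\<delta> (l + 19 * t) - \<delta> (k + 19 * s))\<^sup>2)"
      unfolding W_def by (intro sum_mono group_pair_form_ge[OF assms(1,2) mean mean])
    also have "\<dots> = (\<Sum>k<19. \<Sum>s<m. \<Sum>l<19. \<Sum>t<m. link m d (int l - int k) s t * C19 (int l - int k)
          * (\<delta> (l + 19 * t) - \<delta> (k + 19 * s))\<^sup>2)"
      by (rule sum.cong[OF refl], rule sum.swap)
    also have "\<dots> = (\<Sum>i<19 * m. \<Sum>j<19 * m. blowup m d i j * (C19 (int (j mod 19) - int (i mod 19)) * (\<delta> j - \<delta> i)\<^sup>2))"
      using blowup_sum[of "\<lambda>i j. C19 (int (j mod 19) - int (i mod 19)) * (\<delta> j - \<delta> i)\<^sup>2" _ m d]
      by (simp add: sum_lessThan_mult_eq[of _ 19 m] mult.assoc)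
    finally show "c * (\<Sum>i<19 * m. \<Sum>j<19 * m. (\<delta> j - \<delta> i)\<^sup>2)
      \<le> (\<Sum>i<19 * m. \<Sum>j<19 * m. blowup m d i j * C19 (int (j mod 19) - int (i mod 19)) * (\<delta> j - \<delta> i)\<^sup>2)"
      by (simp only: mult.assoc)
  qed
qed

section \<open>Degrees, connectivity and equilibrium of the network\<close>

lemma network_blowup: "network N (blowup m d)"
proof -
  have "link m d r s t = link m d (- r) t s" for r s t
    by (simp add: link_def add.commute)
  then have "link m d (int k - int l) s t = link m d (int l - int k) t s" for k l s t
    by (metis minus_diff_eq)
  then show ?thesis
    using link_01 by (auto simp: network_def blowup_def)
qed

lemma link_degree_sum: "(\<Sum>l<19. link_degree m d (int l - a)) = 11 * real m + 2 * real d"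
proof -
  have "(\<Sum>l<19. link_degree m d (int l + - a)) = (\<Sum>r<19. link_degree m d (int r))"
    by (rule sum_periodic_shift) (simp_all add: link_degree_def)
  also have "\<dots> = 11 * real m + 2 * real d"
    by (simp add: lessThan_nat_numeral lessThan_Suc link_degree_def near_def far_def)
  finally show ?thesis by simp
qed

text \<open>The 1 subtracted is the loop at \<open>i\<close>, which \<open>link\<close> counts
  because difference 0 is \<open>near\<close>.\<close>

lemma blowup_degree:
  assumes "m > 0" "d \<le> m" "i < 19 * m"
  shows "(\<Sum>j<19 * m. blowup m d i j) = 11 * real m + 2 * real d - 1"
proof -
  have "(\<Sum>j<19 * m. blowup m d i j)
      = (\<Sum>j<19 * m. link m d (int (j mod 19) - int (i mod 19)) (i div 19) (j div 19) - (if j = i then 1 else 0))"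
    by (intro sum.cong refl) (simp add: blowup_def link_def near_def)
  also have "\<dots> = (\<Sum>l<19. \<Sum>t<m. link m d (int l - int (i mod 19)) (i div 19) t) - 1"
  proof -
    have "(\<Sum>j<19 * m. if j = i then 1 else 0) = (1 :: real)"
      using assms by simp
    then show ?thesis
      unfolding sum_subtractf by (simp only: sum_lessThan_mult_eq) simp
  qed
  also have "\<dots> = (\<Sum>l<19. link_degree m d (int l - int (i mod 19))) - 1"
    using sum_link(1)[OF assms(1,2)] by simp
  finally show ?thesis by (simp only: link_degree_sum)
qed

lemma blowup_connectivity:
  assumes "m > 0" "d \<le> m"
  shows "connectivity (19 * m) (blowup m d) = (11 * real m + 2 * real d - 1) / (19 * real m - 1)"
proof -
  have "(\<lambda>i. \<Sum>j<19 * m. blowup m d i j) ` {..<19 * m} = (\<lambda>_. 11 * real m + 2 * real d - 1) ` {..<19 * m}"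
    using blowup_degree[OF assms] by (intro image_cong) auto
  also have "\<dots> = {11 * real m + 2 * real d - 1}"
    using \<open>m > 0\<close> by (auto simp: image_constant_conv lessThan_empty_iff)
  finally have "(\<lambda>i. \<Sum>j<19 * m. blowup m d i j) ` {..<19 * m} = {11 * real m + 2 * real d - 1}" .
  then show ?thesis by (simp add: connectivity_def)
qed

text \<open>By regularity a node feels each group with weight \<open>link_degree\<close>, which is
  even in the group difference while the sine is odd; an odd periodic function sums to 0 over the
  residues.\<close>

lemma blowup_equilibrium:
  assumes "m > 0" "d \<le> m"
  shows "(\<Sum>j<19 * m. blowup m d i j * sin (2 * pi * of_int (int (j mod 19) - int (i mod 19)) / 19)) = 0"
proof -
  define g where "g r = link_degree m d r * sin (2 * pi * of_int r / 19)" for r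
  have per: "g (x mod int 19) = g x" for x
    by (simp add: g_def link_degree_def)
  have odd: "g (- x) = - g x" for x
    by (simp add: g_def link_degree_def)
  have "(\<Sum>r<19. g (int r)) = (\<Sum>r<19. g (0 - int r))"
    by (rule sum_periodic_reflect[symmetric]) (simp, rule per)
  also have "\<dots> = - (\<Sum>r<19. g (int r))"
    by (simp add: odd sum_negf)
  finally have g0: "(\<Sum>r<19. g (int r)) = 0" by simp
  have "(\<Sum>j<19 * m. blowup m d i j * sin (2 * pi * of_int (int (j mod 19) - int (i mod 19)) / 19))
      = (\<Sum>l<19. g (int l + - int (i mod 19)))"
    using blowup_sum[of "\<lambda>i j. sin (2 * pi * of_int (int (j mod 19) - int (i mod 19)) / 19)" i m d]
      sum_link(1)[OF assms] by (simp add: g_def flip: sum_distrib_right)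
  also have "\<dots> = 0"
    using sum_periodic_shift[of 19 g "- int (i mod 19)", OF _ per] g0 by simp
  finally show ?thesis .
qed

lemma blowup_not_globally_synchronizing:
  assumes "m > 0" "d \<le> m"
    and thr: "real d * ((c19 6)\<^sup>2 - c19 6) < real m * (\<Sum>l = 1..5. c19 l - (c19 l)\<^sup>2)"
  shows "\<not> globally_synchronizing (19 * m) (blowup m d)"
proof -
  define \<phi> where "\<phi> i = 2 * pi * real (i mod 19) / 19" for i :: nat
  have diff: "\<phi> j - \<phi> i = 2 * pi * of_int (int (j mod 19) - int (i mod 19)) / 19" for i j
    by (simp add: \<phi>_def right_diff_distrib diff_divide_distrib)
  obtain c where c: "c > 0"
    "\<And>\<delta>. c * (\<Sum>i<19 * m. \<Sum>j<19 * m. (\<delta> j - \<delta> i)\<^sup>2)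
      \<le> (\<Sum>i<19 * m. \<Sum>j<19 * m. blowup m d i j * C19 (int (j mod 19) - int (i mod 19)) * (\<delta> j - \<delta> i)\<^sup>2)"
    using blowup_coercive[OF assms] by blast
  show ?thesis
  proof (rule stable_equilibrium_not_globally_synchronizing[where \<phi> = \<phi> and c = c and a = 0 and b = 1])
    show "network (19 * m) (blowup m d)" by (rule network_blowup)
    show "(\<Sum>j<19 * m. blowup m d i j * sin (\<phi> j - \<phi> i)) = 0" for i
      unfolding diff by (rule blowup_equilibrium[OF assms(1,2)])
    show "c * (\<Sum>i<19 * m. \<Sum>j<19 * m. (\<delta> j - \<delta> i)\<^sup>2)
      \<le> (\<Sum>i<19 * m. \<Sum>j<19 * m. blowup m d i j * cos (\<phi> j - \<phi> i) * (\<delta> j - \<delta> i)\<^sup>2)" for \<delta>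
      unfolding diff by (rule c(2))
    have "cos (\<phi> 1 - \<phi> 0) < 1"
      using c19_bounds(2) by (simp add: \<phi>_def c19_def)
    then show "cis (\<phi> 1 - \<phi> 0) \<noteq> 1"
      by (auto simp: complex_eq_iff)
  qed (use assms c(1) in auto)
qed

section \<open>Approaching the critical density\<close>

lemma not_synchronizing_network_below_threshold:
  assumes x: "0 < x" "x \<le> 1" and thr: "x * ((c19 6)\<^sup>2 - c19 6) = (\<Sum>l = 1..5. c19 l - (c19 l)\<^sup>2)"
    and \<mu>: "\<mu> < 11 / 19 + 2 / 19 * x"
  obtains N A where "N \<ge> 2" "network N A" "connectivity N A \<ge> \<mu>" "\<not> globally_synchronizing N A"
proof -
  let ?b = "11 / 19 + 2 / 19 * x"
  have D: "(c19 6)\<^sup>2 - c19 6 > 0" by (rule c19_threshold_bounds)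
  \<comment> \<open>Rounding \<open>real m * x\<close> down costs at most 1 in \<open>d\<close>,
    hence 2 in the degree, and the missing loop costs 1 more; \<open>\<bar>\<mu>\<bar>\<close>
    absorbs the \<open>- 1\<close> in the denominator of the connectivity.\<close>
  obtain m where m: "real m * (19 * (?b - \<mu>)) > 3 + \<bar>\<mu>\<bar>"
    using reals_Archimedean3[of "19 * (?b - \<mu>)"] \<mu> by (auto simp: mult.commute)
  then have "m > 0"
    by (metis abs_ge_zero add_increasing2 gr0I leD less_eq_real_def mult_zero_left of_nat_0 zero_le_numeral)
  \<comment> \<open>The largest integer strictly below \<open>real m * x\<close>. A floor could
    reach equality, where the mode 1 eigenvalue is 0.\<close>
  define d where "d = nat (\<lceil>real m * x\<rceil> - 1)"
  have "real m * x > 0" using \<open>m > 0\<close> x by simp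
  then have d: "real d < real m * x" "real m * x - 1 \<le> real d"
    unfolding d_def by linarith+
  have "real m * x \<le> real m" using x by (simp add: mult_left_le)
  then have "d \<le> m" using d by linarith
  have "real d * ((c19 6)\<^sup>2 - c19 6) < real m * (\<Sum>l = 1..5. c19 l - (c19 l)\<^sup>2)"
    using mult_strict_right_mono[OF d(1) D] thr by (simp add: mult.assoc)
  then have "\<not> globally_synchronizing (19 * m) (blowup m d)"
    by (rule blowup_not_globally_synchronizing[OF \<open>m > 0\<close> \<open>d \<le> m\<close>])
  moreover have "connectivity (19 * m) (blowup m d) \<ge> \<mu>"
  proof -
    have "real m \<ge> 1" using \<open>m > 0\<close> by simp
    have "\<mu> * (19 * real m - 1) \<le> 11 * real m + 2 * (real m * x - 1) - 1"
      using m by (simp add: algebra_simps abs_if split: if_splits)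
    also have "\<dots> \<le> 11 * real m + 2 * real d - 1" using d by simp
    finally show ?thesis
      unfolding blowup_connectivity[OF \<open>m > 0\<close> \<open>d \<le> m\<close>] using \<open>real m \<ge> 1\<close>
      by (simp add: pos_le_divide_eq)
  qed
  ultimately show thesis
    using that[of "19 * m" "blowup m d"] network_blowup \<open>m > 0\<close> by simp
qed

text \<open>Ensures that the set whose infimum is \<open>critical_connectivity\<close> is nonempty:
  a \<open>\<mu>\<close> above 1 belongs to it vacuously.\<close>

lemma connectivity_le_1:
  assumes "N \<ge> 2" "network N A"
  shows "connectivity N A \<le> 1"
proof -
  have "A 0 j \<le> (if j = 0 then 0 else 1)" if "j < N" for j
  proof -
    have "A 0 j \<in> {0, 1}" "A 0 0 = 0"
      using assms that unfolding network_def by auto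
    then show ?thesis by auto
  qed
  then have "(\<Sum>j<N. A 0 j) \<le> (\<Sum>j<N. if j = 0 then 0 else 1)"
    by (intro sum_mono) auto
  also have "\<dots> = real N - 1"
  proof -
    obtain n where "N = Suc n"
      using assms(1) by (cases N) auto
    then show ?thesis by (simp add: sum.lessThan_Suc_shift del: sum.lessThan_Suc)
  qed
  finally have "(\<Sum>j<N. A 0 j) \<le> real N - 1" .
  moreover have "(MIN i\<in>{..<N}. \<Sum>j<N. A i j) \<le> (\<Sum>j<N. A 0 j)"
    using assms(1) by (intro Min_le) auto
  ultimately have "(MIN i\<in>{..<N}. \<Sum>j<N. A i j) \<le> real N - 1"
    by linarith
  then show ?thesis
    using assms(1) unfolding connectivity_def by (intro divide_le_eq_1_pos[THEN iffD2]) auto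
qed

theorem mainTheorem3:
  shows "let b = 11 / 19 - 2 / 19 *
           ((\<Sum>l = 1..(5::nat). - cos (2 * pi * real l / 19) + (cos (2 * pi * real l / 19))\<^sup>2)
             / (- cos (12 * pi / 19) + (cos (12 * pi / 19))\<^sup>2))
         in critical_connectivity \<ge> b \<and> 0.6838 \<le> b \<and> b < 0.6839"
proof -
  let ?S = "\<Sum>l = 1..5. c19 l - (c19 l)\<^sup>2" and ?D = "(c19 6)\<^sup>2 - c19 6"
  define x where "x = ?S / ?D"
  define b where "b = 11 / 19 + 2 / 19 * x"
  have "(\<Sum>l = 1..(5::nat). - cos (2 * pi * real l / 19) + (cos (2 * pi * real l / 19))\<^sup>2) = - ?S"
    by (simp add: c19_def flip: sum_negf)
  moreover have "cos (12 * pi / 19) = c19 6"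
    by (simp add: c19_def)
  ultimately have b: "11 / 19 - 2 / 19 *
           ((\<Sum>l = 1..(5::nat). - cos (2 * pi * real l / 19) + (cos (2 * pi * real l / 19))\<^sup>2)
             / (- cos (12 * pi / 19) + (cos (12 * pi / 19))\<^sup>2)) = b"
    by (simp add: b_def x_def)
  have x: "0.9965 \<le> x" "x \<le> 0.997" "x * ?D = ?S"
    using c19_threshold_bounds by (simp_all add: x_def pos_le_divide_eq pos_divide_le_eq)
  have "b \<le> critical_connectivity"
    unfolding critical_connectivity_def
  proof (rule cInf_greatest)
    have "\<not> connectivity N A \<ge> 2" if "N \<ge> 2" "network N A" for N A
      using connectivity_le_1[OF that] by simp
    then show "{\<mu>. \<forall>N A. N \<ge> 2 \<longrightarrow> network N A \<longrightarrow> connectivity N A \<ge> \<mu> \<longrightarrow> globally_synchronizing N A} \<noteq> {}"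
      by blast
  next
    fix \<mu> assume \<mu>: "\<mu> \<in> {\<mu>. \<forall>N A. N \<ge> 2 \<longrightarrow> network N A \<longrightarrow> connectivity N A \<ge> \<mu> \<longrightarrow> globally_synchronizing N A}"
    show "b \<le> \<mu>"
    proof (rule ccontr)
      assume "\<not> b \<le> \<mu>"
      then have below: "\<mu> < 11 / 19 + 2 / 19 * x" by (simp add: b_def)
      have "0 < x" "x \<le> 1" using x by simp_all
      then obtain N A where "N \<ge> 2" "network N A" "connectivity N A \<ge> \<mu>" "\<not> globally_synchronizing N A"
        by (rule not_synchronizing_network_below_threshold[OF _ _ x(3) below])
      then show False using \<mu> by blast
    qed
  qed
  moreover have "0.6838 \<le> b" "b < 0.6839"
    using x by (simp_all add: b_def)
  ultimately show ?thesis
    by (simp only: b Let_def)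
qed

end
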